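(* Let $\mathcal{B} \subset \mathcal{A}$ be a regular irreducible inclusion of simple unital $C^*$-algebras such that there exists a finite-index conditional expectation from $\mathcal{A}$ onto $\mathcal{B}$. Then its Weyl group $G := \mathcal{N}_{\mathcal{A}}(\mathcal{B})/\mathcal{U}(\mathcal{B})$ admits an outer cocycle action $(\alpha,\sigma)$ on $\mathcal{B}$ such that $(\mathcal{B} \subset \mathcal{A}) \cong (\mathcal{B} \subset \mathcal{B} \rtimes^r_{(\alpha,\sigma)} G)$.
   Context: Inclusions of unital $C^*$-algebras have a common unit; $\mathcal{U}(\cdot)$ denotes the unitary group. A conditional expectation $E: \mathcal{A} \to \mathcal{B}$ has finite index if there is a finite set $\{\lambda_i\} \subset \mathcal{A}$ with $x = \sum_i E(x\lambda_i)\lambda_i^*$ for all $x \in \mathcal{A}$. The normalizer is $\mathcal{N}_{\mathcal{A}}(\mathcal{B}) = \{u \in \mathcal{U}(\mathcal{A}) : u\mathcal{B}u^* = \mathcal{B}\}$. The inclusion is regular if $\mathcal{N}_{\mathcal{A}}(\mathcal{B})$ generates $\mathcal{A}$ as a $C^*$-algebra, and irreducible if $\mathcal{B}' \cap \mathcal{A} = \mathbb{C}$. A cocycle action of a discrete group $G$ on a unital $C^*$-algebra $\mathcal{B}$ is a pair $(\alpha,\sigma)$ of maps $\alpha: G \to \mathrm{Aut}(\mathcal{B})$ and $\sigma: G \times G \to \mathcal{U}(\mathcal{B})$ such that, for all $g,h,k \in G$, $\alpha_g \circ \alpha_h = \mathrm{Ad}(\sigma(g,h)) \circ \alpha_{gh}$,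 $\sigma(g,h)\sigma(gh,k) = \alpha_g(\sigma(h,k))\sigma(g,hk)$, and $\sigma(g,e) = \sigma(e,g) = 1$. It is outer if $\alpha_g$ is not an inner automorphism of $\mathcal{B}$ for every $g \neq e$. The reduced twisted crossed product $\mathcal{B} \rtimes^r_{(\alpha,\sigma)} G$ is the $C^*$-algebra generated by a copy of $\mathcal{B}$ and unitaries $u_g$ ($g \in G$) with $u_g u_h = \sigma(g,h)u_{gh}$ and $u_g x u_g^* = \alpha_g(x)$ for $x \in \mathcal{B}$, carrying a faithful conditional expectation onto $\mathcal{B}$ that vanishes on $u_g$ for $g \neq e$. The notation $(\mathcal{B} \subset \mathcal{A}) \cong (\mathcal{B} \subset \mathcal{D})$ means that there is a $*$-isomorphism of $\mathcal{A}$ onto $\mathcal{D}$ carrying $\mathcal{B}$ onto $\mathcal{B}$. *)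

theory Defs
  imports "HOL-Analysis.Analysis" "HOL-Algebra.Coset"
begin

section \<open>Unital C*-algebras and their unital C*-subalgebras\<close>

text \<open>A type of this class is a nonzero unital complex C*-algebra; submultiplicativity of the norm
  and \<open>norm 1 = 1\<close> come from \<^class>\<open>real_normed_algebra_1\<close>, completeness from \<^class>\<open>banach\<close>.\<close>

class unital_cstar_algebra = banach + real_normed_algebra_1 +
  fixes scaleC :: "complex \<Rightarrow> 'a \<Rightarrow> 'a"
    and star :: "'a \<Rightarrow> 'a"
  assumes scaleC_of_real: "scaleC (complex_of_real r) x = scaleR r x"
    and scaleC_add_right: "scaleC c (x + y) = scaleC c x + scaleC c y"
    and scaleC_add_left: "scaleC (c + d) x = scaleC c x + scaleC d x"
    and scaleC_scaleC: "scaleC c (scaleC d x) = scaleC (c * d) x"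
    and norm_scaleC: "norm (scaleC c x) = cmod c * norm x"
    and scaleC_mult_left: "scaleC c x * y = scaleC c (x * y)"
    and scaleC_mult_right: "x * scaleC c y = scaleC c (x * y)"
    and star_star: "star (star x) = x"
    and star_add: "star (x + y) = star x + star y"
    and star_scaleC: "star (scaleC c x) = scaleC (cnj c) (star x)"
    and star_mult: "star (x * y) = star y * star x"
    and cstar_identity: "norm (star x * x) = (norm x)\<^sup>2"

instantiation complex :: unital_cstar_algebra
begin

definition scaleC_complex :: "complex \<Rightarrow> complex \<Rightarrow> complex" where
  "scaleC_complex c x = c * x"

definition star_complex :: "complex \<Rightarrow> complex" where
  "star_complex x = cnj x"

instance
  by standard
    (simp_all add: scaleC_complex_def star_complex_def scaleR_conv_of_real algebra_simps norm_mult
      power2_eq_square)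

end

definition cstar_subalgebra :: "'a::unital_cstar_algebra set \<Rightarrow> bool" where
  "cstar_subalgebra B \<longleftrightarrow>
     1 \<in> B \<and> closed B \<and>
     (\<forall>x\<in>B. \<forall>y\<in>B. x + y \<in> B \<and> x * y \<in> B) \<and>
     (\<forall>c. \<forall>x\<in>B. scaleC c x \<in> B) \<and>
     (\<forall>x\<in>B. star x \<in> B)"

definition cstar_generated :: "'a::unital_cstar_algebra set \<Rightarrow> 'a set" where
  "cstar_generated S = \<Inter>{C. cstar_subalgebra C \<and> S \<subseteq> C}"

definition closed_two_sided_ideal :: "'a::unital_cstar_algebra set \<Rightarrow> 'a set \<Rightarrow> bool" where
  "closed_two_sided_ideal I B \<longleftrightarrow>
     I \<subseteq> B \<and> 0 \<in> I \<and> closed I \<and>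
     (\<forall>x\<in>I. \<forall>y\<in>I. x + y \<in> I) \<and>
     (\<forall>c. \<forall>x\<in>I. scaleC c x \<in> I) \<and>
     (\<forall>x\<in>I. \<forall>b\<in>B. b * x \<in> I \<and> x * b \<in> I)"

definition simple_cstar :: "'a::unital_cstar_algebra set \<Rightarrow> bool" where
  "simple_cstar B \<longleftrightarrow> (\<forall>I. closed_two_sided_ideal I B \<longrightarrow> I = {0} \<or> I = B)"

definition unitaries :: "'a::unital_cstar_algebra set \<Rightarrow> 'a set" where
  "unitaries B = {u \<in> B. star u * u = 1 \<and> u * star u = 1}"

definition star_hom_on ::
  "'a::unital_cstar_algebra set \<Rightarrow> ('a \<Rightarrow> 'b::unital_cstar_algebra) \<Rightarrow> bool" where
  "star_hom_on B f \<longleftrightarrow>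
     (\<forall>x\<in>B. \<forall>y\<in>B. f (x + y) = f x + f y \<and> f (x * y) = f x * f y) \<and>
     (\<forall>c. \<forall>x\<in>B. f (scaleC c x) = scaleC c (f x)) \<and>
     (\<forall>x\<in>B. f (star x) = star (f x))"

definition star_iso_on ::
  "'a::unital_cstar_algebra set \<Rightarrow> 'b::unital_cstar_algebra set \<Rightarrow> ('a \<Rightarrow> 'b) \<Rightarrow> bool" where
  "star_iso_on B C f \<longleftrightarrow> star_hom_on B f \<and> bij_betw f B C"

section \<open>Conditional expectations\<close>

definition spectrum :: "'a::unital_cstar_algebra \<Rightarrow> complex set" where
  "spectrum x = {c. \<not> (\<exists>y. y * (x - scaleC c 1) = 1 \<and> (x - scaleC c 1) * y = 1)}"

definition positive_element :: "'a::unital_cstar_algebra \<Rightarrow> bool" where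
  "positive_element x \<longleftrightarrow> star x = x \<and> spectrum x \<subseteq> complex_of_real ` {0..}"

text \<open>A contractive positive linear projection of the whole algebra onto \<open>B\<close> that is a
  \<open>B\<close>-bimodule map.\<close>

definition conditional_expectation ::
  "('a::unital_cstar_algebra \<Rightarrow> 'a) \<Rightarrow> 'a set \<Rightarrow> bool" where
  "conditional_expectation E B \<longleftrightarrow>
     (\<forall>x y. E (x + y) = E x + E y) \<and>
     (\<forall>c x. E (scaleC c x) = scaleC c (E x)) \<and>
     (\<forall>x. E x \<in> B) \<and>
     (\<forall>b\<in>B. E b = b) \<and>
     (\<forall>b\<in>B. \<forall>c\<in>B. \<forall>x. E (b * x * c) = b * E x * c) \<and>
     (\<forall>x. positive_element (E (star x * x))) \<and>
     (\<forall>x. norm (E x) \<le> norm x)"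

definition faithful :: "('a::unital_cstar_algebra \<Rightarrow> 'a) \<Rightarrow> bool" where
  "faithful E \<longleftrightarrow> (\<forall>x. E (star x * x) = 0 \<longrightarrow> x = 0)"

definition finite_index :: "('a::unital_cstar_algebra \<Rightarrow> 'a) \<Rightarrow> bool" where
  "finite_index E \<longleftrightarrow> (\<exists>\<Lambda>. finite \<Lambda> \<and> (\<forall>x. x = (\<Sum>l\<in>\<Lambda>. E (x * l) * star l)))"

section \<open>Normalizers and the Weyl group\<close>

definition normalizer :: "'a::unital_cstar_algebra set \<Rightarrow> 'a set" where
  "normalizer B = {u \<in> unitaries UNIV. (\<lambda>b. u * b * star u) ` B = B}"

definition normalizer_group :: "'a::unital_cstar_algebra set \<Rightarrow> 'a monoid" where
  "normalizer_group B = \<lparr>carrier = normalizer B, monoid.mult = (*), one = 1\<rparr>"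

definition weyl_group :: "'a::unital_cstar_algebra set \<Rightarrow> 'a set monoid" where
  "weyl_group B = normalizer_group B Mod unitaries B"

definition regular_inclusion :: "'a::unital_cstar_algebra set \<Rightarrow> bool" where
  "regular_inclusion B \<longleftrightarrow> cstar_generated (normalizer B) = UNIV"

definition irreducible_inclusion :: "'a::unital_cstar_algebra set \<Rightarrow> bool" where
  "irreducible_inclusion B \<longleftrightarrow> {x. \<forall>b\<in>B. x * b = b * x} = range (\<lambda>c. scaleC c 1)"

section \<open>Cocycle actions and reduced twisted crossed products\<close>

definition cocycle_action ::
  "('g, 'm) monoid_scheme \<Rightarrow> 'a::unital_cstar_algebra set \<Rightarrow>
   ('g \<Rightarrow> 'a \<Rightarrow> 'a) \<Rightarrow> ('g \<Rightarrow> 'g \<Rightarrow> 'a) \<Rightarrow> bool" where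
  "cocycle_action G B \<alpha> \<sigma> \<longleftrightarrow>
     group G \<and>
     (\<forall>g\<in>carrier G. star_iso_on B B (\<alpha> g)) \<and>
     (\<forall>g\<in>carrier G. \<forall>h\<in>carrier G. \<sigma> g h \<in> unitaries B) \<and>
     (\<forall>g\<in>carrier G. \<forall>h\<in>carrier G. \<forall>b\<in>B.
        \<alpha> g (\<alpha> h b) = \<sigma> g h * \<alpha> (g \<otimes>\<^bsub>G\<^esub> h) b * star (\<sigma> g h)) \<and>
     (\<forall>g\<in>carrier G. \<forall>h\<in>carrier G. \<forall>k\<in>carrier G.
        \<sigma> g h * \<sigma> (g \<otimes>\<^bsub>G\<^esub> h) k = \<alpha> g (\<sigma> h k) * \<sigma> g (h \<otimes>\<^bsub>G\<^esub> k)) \<and>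
     (\<forall>g\<in>carrier G. \<sigma> g \<one>\<^bsub>G\<^esub> = 1 \<and> \<sigma> \<one>\<^bsub>G\<^esub> g = 1)"

definition outer_action ::
  "('g, 'm) monoid_scheme \<Rightarrow> 'a::unital_cstar_algebra set \<Rightarrow> ('g \<Rightarrow> 'a \<Rightarrow> 'a) \<Rightarrow> bool" where
  "outer_action G B \<alpha> \<longleftrightarrow>
     (\<forall>g\<in>carrier G. g \<noteq> \<one>\<^bsub>G\<^esub> \<longrightarrow>
        \<not> (\<exists>w\<in>unitaries B. \<forall>b\<in>B. \<alpha> g b = w * b * star w))"

text \<open>The C*-algebra \<open>'d\<close>, with the copy \<open>\<iota> ` B\<close> of \<open>B\<close>, the unitaries \<open>u g\<close> and the expectation
  \<open>E\<close>, is the reduced twisted crossed product of \<open>B\<close> by \<open>(\<alpha>, \<sigma>)\<close>. The faithfulness of \<open>E\<close> is what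
  singles out the reduced completion and determines \<open>'d\<close> up to isomorphism. Only the restriction
  of \<open>\<iota>\<close> to \<open>B\<close> and the values of \<open>u\<close> on the carrier of \<open>G\<close> matter.\<close>

definition reduced_crossed_product ::
  "('g, 'm) monoid_scheme \<Rightarrow> 'a::unital_cstar_algebra set \<Rightarrow>
   ('g \<Rightarrow> 'a \<Rightarrow> 'a) \<Rightarrow> ('g \<Rightarrow> 'g \<Rightarrow> 'a) \<Rightarrow>
   ('a \<Rightarrow> 'd::unital_cstar_algebra) \<Rightarrow> ('g \<Rightarrow> 'd) \<Rightarrow> ('d \<Rightarrow> 'd) \<Rightarrow> bool" where
  "reduced_crossed_product G B \<alpha> \<sigma> \<iota> u E \<longleftrightarrow>
     star_iso_on B (\<iota> ` B) \<iota> \<and> \<iota> 1 = 1 \<and>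
     (\<forall>g\<in>carrier G. u g \<in> unitaries UNIV) \<and>
     (\<forall>g\<in>carrier G. \<forall>h\<in>carrier G. u g * u h = \<iota> (\<sigma> g h) * u (g \<otimes>\<^bsub>G\<^esub> h)) \<and>
     (\<forall>g\<in>carrier G. \<forall>b\<in>B. u g * \<iota> b * star (u g) = \<iota> (\<alpha> g b)) \<and>
     cstar_generated (\<iota> ` B \<union> u ` carrier G) = UNIV \<and>
     conditional_expectation E (\<iota> ` B) \<and> faithful E \<and>
     (\<forall>g\<in>carrier G. g \<noteq> \<one>\<^bsub>G\<^esub> \<longrightarrow> E (u g) = 0)"

definition inclusions_isomorphic ::
  "'a::unital_cstar_algebra set \<Rightarrow> 'd::unital_cstar_algebra set \<Rightarrow> bool" where
  "inclusions_isomorphic B C \<longleftrightarrow> (\<exists>\<Phi>::'a \<Rightarrow> 'd. star_iso_on UNIV UNIV \<Phi> \<and> \<Phi> ` B = C)"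

end

theory Submission
  imports Defs
begin

text \<open>
  The key observation is that an expectation onto \<open>B\<close> vanishes on every normalizing unitary \<open>v\<close>
  outside \<open>B\<close>. Indeed \<open>star v * E v\<close> commutes with \<open>B\<close>, so it is a scalar by irreducibility; if
  the scalar were nonzero, \<open>v\<close> would be a multiple of \<open>E v\<close> and lie in \<open>B\<close>
  (\<open>expectation_normalizer_eq_0\<close>). Choose a representative \<open>v g\<close> in every coset \<open>g\<close> of the Weyl
  group, with \<open>1\<close> for the neutral coset. Then \<open>\<alpha> g = Ad (v g)\<close> and
  \<open>\<sigma> g h = v g * v h * star (v (g \<otimes> h))\<close> form a cocycle action, which is outer because
  \<open>Ad (v g) = Ad w\<close> on \<open>B\<close> makes \<open>star w * v g\<close> a scalar. By regularity \<open>B\<close> and the \<open>v g\<close>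
  generate the algebra, and distinct \<open>v g\<close> are orthogonal for \<open>E\<close>. What is left is the
  faithfulness of \<open>E\<close> and the comparison with an arbitrary crossed product.

  Finite index makes the Weyl group finite (\<open>finite_index_imp_finite_group\<close>): the quasi-basis is
  approximated by combinations of finitely many monomials \<open>b * v g\<close>, so for all but finitely many
  \<open>h\<close> the coefficients of \<open>v h\<close> in the quasi-basis would be small, and \<open>v h\<close> with them.
  Over a finite group every element equals its Fourier expansion
  \<open>\<Sum>g. E (x * star (v g)) * v g\<close> exactly (\<open>fourier_expansion\<close>). This holds in every crossed product
  by the same action, whence the coefficient-wise map between any two of them is a
  *-isomorphism (\<open>crossed_systems_isomorphic\<close>).

  For the faithfulness (\<open>faithful_E\<close>), \<open>E (star x * x) = 0\<close> forces \<open>star p * p\<close> and its negative to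
  be positive for each Fourier component \<open>p\<close> of \<open>x\<close>. A self-adjoint element with spectrum in \<open>{0}\<close>
  vanishes (\<open>self_adjoint_spectrum_0\<close>), which is proved by averaging the resolvent over roots of
  unity.
\<close>

section \<open>Elementary facts on C*-algebras\<close>

lemma scaleC_zero [simp]: "scaleC c (0::'a::unital_cstar_algebra) = 0"
  using scaleC_add_right[of c 0 "0::'a"] by simp

lemma scaleC_0 [simp]: "scaleC 0 (x::'a::unital_cstar_algebra) = 0"
  using scaleC_of_real[of 0 x] by simp

lemma scaleC_1 [simp]: "scaleC 1 (x::'a::unital_cstar_algebra) = x"
  using scaleC_of_real[of 1 x] by simp

lemma scaleC_minus1: "scaleC (-1) (x::'a::unital_cstar_algebra) = - x"
  using scaleC_of_real[of "-1" x] by simp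

lemma scaleC_minus_left: "scaleC (- c) (x::'a::unital_cstar_algebra) = - scaleC c x"
  using scaleC_add_left[of "-c" c x] by (simp add: eq_neg_iff_add_eq_0)

lemma scaleC_minus_right: "scaleC c (- x) = - scaleC c (x::'a::unital_cstar_algebra)"
  using scaleC_add_right[of c "-x" x] by (simp add: eq_neg_iff_add_eq_0)

lemma scaleC_diff_right: "scaleC c (x - y) = scaleC c x - scaleC c (y::'a::unital_cstar_algebra)"
  using scaleC_add_right[of c x "-y"] by (simp add: scaleC_minus_right)

lemma scaleC_diff_left: "scaleC (c - d) x = scaleC c x - scaleC d (x::'a::unital_cstar_algebra)"
  using scaleC_add_left[of c "-d" x] by (simp add: scaleC_minus_left)

lemma scaleC_sum: "scaleC c (\<Sum>i\<in>I. f i) = (\<Sum>i\<in>I. scaleC c (f i :: 'a::unital_cstar_algebra))"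
  by (induction I rule: infinite_finite_induct) (simp_all add: scaleC_add_right)

lemma star_0 [simp]: "star (0::'a::unital_cstar_algebra) = 0"
  using star_add[of 0 "0::'a"] by simp

lemma star_1 [simp]: "star (1::'a::unital_cstar_algebra) = 1"
  by (metis mult.right_neutral star_mult star_star)

lemma star_minus: "star (- x) = - star (x::'a::unital_cstar_algebra)"
  using star_add[of "-x" x] by (simp add: eq_neg_iff_add_eq_0)

lemma star_diff: "star (x - y) = star x - star (y::'a::unital_cstar_algebra)"
  using star_add[of x "-y"] by (simp add: star_minus)

lemma star_sum: "star (\<Sum>i\<in>I. f i) = (\<Sum>i\<in>I. star (f i :: 'a::unital_cstar_algebra))"
  by (induction I rule: infinite_finite_induct) (simp_all add: star_add)

lemma star_mult_self_eq_0: "star x * x = 0 \<Longrightarrow> (x::'a::unital_cstar_algebra) = 0"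
  using cstar_identity[of x] by simp

lemma norm_star: "norm (star x) = norm (x::'a::unital_cstar_algebra)"
proof -
  have le: "norm y \<le> norm (star y)" for y :: 'a
  proof (cases "y = 0")
    case False
    have "norm y * norm y \<le> norm (star y) * norm y"
      using cstar_identity[of y] norm_mult_ineq[of "star y" y] by (simp add: power2_eq_square)
    then show ?thesis using False by simp
  qed simp
  show ?thesis using le[of x] le[of "star x"] by (simp add: star_star)
qed

lemma norm_unitary: "u \<in> unitaries B \<Longrightarrow> norm (u::'a::unital_cstar_algebra) = 1"
  using cstar_identity[of u] by (simp add: unitaries_def power2_eq_1_iff) (smt (verit) norm_ge_zero)

lemma bounded_linear_star: "bounded_linear (star :: 'a::unital_cstar_algebra \<Rightarrow> 'a)"
  by (rule bounded_linear_intro[where K = 1])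
    (simp_all add: star_add norm_star star_scaleC flip: scaleC_of_real)

lemma bounded_linear_scaleC: "bounded_linear (scaleC c :: 'a::unital_cstar_algebra \<Rightarrow> 'a)"
  by (rule bounded_linear_intro[where K = "cmod c"])
    (simp_all add: scaleC_add_right norm_scaleC scaleC_scaleC mult.commute flip: scaleC_of_real)

definition unital_star_subalgebra :: "'a::unital_cstar_algebra set \<Rightarrow> bool" where
  "unital_star_subalgebra P \<longleftrightarrow>
     1 \<in> P \<and> (\<forall>x\<in>P. \<forall>y\<in>P. x + y \<in> P \<and> x * y \<in> P) \<and>
     (\<forall>c. \<forall>x\<in>P. scaleC c x \<in> P) \<and> (\<forall>x\<in>P. star x \<in> P)"

lemma cstar_subalgebra_imp_star_subalgebra:
  "cstar_subalgebra B \<Longrightarrow> unital_star_subalgebra B"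
  by (simp add: cstar_subalgebra_def unital_star_subalgebra_def)

lemma cstar_subalgebra_closure:
  fixes P :: "'a::unital_cstar_algebra set"
  assumes P: "unital_star_subalgebra P"
  shows "cstar_subalgebra (closure P)"
proof -
  have lin: "f x \<in> closure P"
    if "bounded_linear f" "\<And>x. x \<in> P \<Longrightarrow> f x \<in> P" "x \<in> closure P" for f :: "'a \<Rightarrow> 'a" and x
  proof -
    have "f ` closure P \<subseteq> closure (f ` P)"
      using that(1) by (rule closure_bounded_linear_image_subset)
    also have "\<dots> \<subseteq> closure P" using that(2) by (intro closure_mono) auto
    finally show ?thesis using that(3) by auto
  qed
  have "x + y \<in> closure P" if xy: "x \<in> closure P" "y \<in> closure P" for x y
  proof -
    obtain X Y where "\<And>n. X n \<in> P" "X \<longlonglongrightarrow> x" "\<And>n. Y n \<in> P" "Y \<longlonglongrightarrow> y"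
      using xy by (auto simp: closure_sequential)
    then show ?thesis
      unfolding closure_sequential using P
      by (intro exI[of _ "\<lambda>n. X n + Y n"]) (auto simp: unital_star_subalgebra_def intro: tendsto_add)
  qed
  moreover have "x * y \<in> closure P" if xy: "x \<in> closure P" "y \<in> closure P" for x y
  proof -
    obtain X Y where "\<And>n. X n \<in> P" "X \<longlonglongrightarrow> x" "\<And>n. Y n \<in> P" "Y \<longlonglongrightarrow> y"
      using xy by (auto simp: closure_sequential)
    then show ?thesis
      unfolding closure_sequential using P
      by (intro exI[of _ "\<lambda>n. X n * Y n"]) (auto simp: unital_star_subalgebra_def intro: tendsto_mult)
  qed
  moreover have "scaleC c x \<in> closure P" if "x \<in> closure P" for c x
    using P that by (intro lin[OF bounded_linear_scaleC]) (auto simp: unital_star_subalgebra_def)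
  moreover have "star x \<in> closure P" if "x \<in> closure P" for x
    using P that by (intro lin[OF bounded_linear_star]) (auto simp: unital_star_subalgebra_def)
  moreover have "1 \<in> closure P"
    using P closure_subset by (auto simp: unital_star_subalgebra_def)
  ultimately show ?thesis by (simp add: cstar_subalgebra_def)
qed

lemma cstar_generated_least: "cstar_subalgebra C \<Longrightarrow> S \<subseteq> C \<Longrightarrow> cstar_generated S \<subseteq> C"
  by (auto simp: cstar_generated_def)

lemma unitaries_mult:
  "unital_star_subalgebra B \<Longrightarrow> u \<in> unitaries B \<Longrightarrow> v \<in> unitaries B \<Longrightarrow> u * v \<in> unitaries B"
  unfolding unitaries_def unital_star_subalgebra_def
  by (auto simp: star_mult mult.assoc) (metis mult.assoc mult.left_neutral)+

lemma unitaries_star: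
  "unital_star_subalgebra B \<Longrightarrow> u \<in> unitaries B \<Longrightarrow> star u \<in> unitaries B"
  by (auto simp: unitaries_def unital_star_subalgebra_def star_star)

lemma unitary_cancel:
  assumes "u \<in> unitaries B"
  shows "star u * u = 1" "u * star u = 1" "star u * (u * x) = x" "u * (star u * x) = x"
  using assms by (simp_all add: unitaries_def flip: mult.assoc)

section \<open>Self-adjoint elements with trivial spectrum\<close>

definition is_inverse :: "'a::unital_cstar_algebra \<Rightarrow> 'a \<Rightarrow> bool" where
  "is_inverse y x \<longleftrightarrow> y * x = 1 \<and> x * y = 1"

lemma norm_mult3_le: "norm (x * y * z) \<le> norm x * norm y * norm (z::'a::real_normed_algebra)"
  by (rule order_trans[OF norm_mult_ineq mult_right_mono[OF norm_mult_ineq norm_ge_zero]])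

lemma is_inverse_diff:
  assumes "is_inverse y x" "is_inverse y' x'"
  shows "y - y' = y * (x' - x) * y'"
proof -
  have "y * (x' - x) * y' = y * (x' * y') - (y * x) * y'" by (simp add: algebra_simps)
  then show ?thesis using assms by (simp add: is_inverse_def)
qed

text \<open>The resolvent identity \<open>R z - R w = (z - w) R z a R w\<close> gives \<open>norm (R z) \<le> 2 * norm (R w)\<close> as soon
  as \<open>z\<close> is close to \<open>w\<close>; inserted back, this local bound makes \<open>R\<close> locally Lipschitz.\<close>

lemma resolvent_continuous:
  fixes a :: "'a::unital_cstar_algebra"
  assumes R: "\<And>z. is_inverse (R z) (1 - scaleC z a)"
  shows "continuous_on UNIV R"
proof -
  have "isCont R w" for w
  proof -
    define k where "k = norm a * norm (R w)"
    have k0: "k \<ge> 0" by (simp add: k_def)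
    have diff: "norm (R z - R w) \<le> norm (R z) * (cmod (z - w) * k)" for z
    proof -
      have "R z - R w = R z * (scaleC (z - w) a) * R w"
        using is_inverse_diff[OF R R, of z w] by (simp add: scaleC_diff_left)
      also have "norm \<dots> \<le> norm (R z) * (cmod (z - w) * norm a) * norm (R w)"
        using norm_mult3_le[of "R z" "scaleC (z - w) a" "R w"] by (simp add: norm_scaleC)
      finally show ?thesis by (simp add: k_def algebra_simps)
    qed
    have "((\<lambda>z. cmod (z - w) * k) \<longlongrightarrow> cmod (w - w) * k) (at w)"
      by (intro tendsto_intros)
    then have small: "\<forall>\<^sub>F z in at w. cmod (z - w) * k < 1/2"
      by (auto dest: order_tendstoD(2)[where a = "1/2"])
    have bound: "\<forall>\<^sub>F z in at w. norm (R z - R w) \<le> 2 * norm (R w) * (cmod (z - w) * k)"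
      using small
    proof eventually_elim
      case (elim z)
      have "norm (R z) \<le> norm (R w) + norm (R z - R w)" using norm_triangle_sub[of "R z" "R w"] by simp
      also have "norm (R z - R w) \<le> norm (R z) * (1/2)"
        using diff[of z] elim by (smt (verit) mult_left_mono norm_ge_zero)
      finally have "norm (R z) \<le> 2 * norm (R w)" by simp
      then show ?case using diff[of z] k0
        by (smt (verit) mult_right_mono mult_nonneg_nonneg norm_ge_zero)
    qed
    have "((\<lambda>z. 2 * norm (R w) * (cmod (z - w) * k)) \<longlongrightarrow> 2 * norm (R w) * (cmod (w - w) * k)) (at w)"
      by (intro tendsto_intros)
    then have "((\<lambda>z. R z - R w) \<longlongrightarrow> 0) (at w)"
      by (intro Lim_null_comparison[OF bound]) simp
    then show ?thesis by (simp add: isCont_def LIM_zero_iff)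
  qed
  then show ?thesis by (simp add: continuous_at_imp_continuous_on)
qed

text \<open>The averaging step for the roots of unity: \<open>1 / (1 - w) + 1 / (1 + w) = 2 / (1 - w * w)\<close>.\<close>

lemma is_inverse_square:
  fixes w :: "'a::unital_cstar_algebra"
  assumes X: "is_inverse X (1 - w)" and Y: "is_inverse Y (1 + w)"
  shows "is_inverse (scaleC (1/2) (X + Y)) (1 - w * w)"
proof -
  have f: "1 - w * w = (1 - w) * (1 + w)" "1 - w * w = (1 + w) * (1 - w)"
    by (simp_all add: algebra_simps)
  have half: "scaleC (1/2) ((1 + w) + (1 - w)) = (1::'a)"
  proof -
    have "(1 + w) + (1 - w) = scaleC 2 (1::'a)"
      using scaleC_add_left[of 1 1 "1::'a"] by simp
    then show ?thesis by (simp only: scaleC_scaleC) simp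
  qed
  have "X * (1 - w * w) = 1 + w" "Y * (1 - w * w) = 1 - w"
    using X Y by (simp add: f(1) is_inverse_def flip: mult.assoc,
        simp add: f(2) is_inverse_def flip: mult.assoc)
  then have 1: "(X + Y) * (1 - w * w) = (1 + w) + (1 - w)" by (simp only: distrib_right)
  have "(1 - w * w) * X = 1 + w" "(1 - w * w) * Y = 1 - w"
    using X Y by (simp add: f(2) is_inverse_def mult.assoc,
        simp add: f(1) is_inverse_def mult.assoc)
  then have 2: "(1 - w * w) * (X + Y) = (1 + w) + (1 - w)" by (simp only: distrib_left)
  show ?thesis unfolding is_inverse_def
    by (simp only: scaleC_mult_left scaleC_mult_right 1 2 half)
qed

text \<open>A special case of the spectral radius formula. Averaging the resolvent over the
  \<open>2 ^ n\<close>-th roots of unity turns \<open>(1 - z a) \<inverse>\<close> into \<open>(1 - z ^ 2 ^ n a ^ 2 ^ n) \<inverse>\<close>, and averaging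
  does not increase the variation of the resolvent between two concentric circles. If
  \<open>norm a = 1\<close>, take radii \<open>s < 1 < t\<close>: as \<open>n\<close> grows, the inverse on the inner circle tends to \<open>1\<close>,
  so that on the outer circle stays near \<open>1\<close>, although \<open>t ^ 2 ^ n a ^ 2 ^ n\<close> has norm at least \<open>1\<close>
  because \<open>norm (a ^ 2 ^ n) = 1\<close> by the C*-identity.\<close>

lemma self_adjoint_spectrum_0_norm:
  fixes a :: "'a::unital_cstar_algebra"
  assumes sa: "star a = a" and sp: "spectrum a \<subseteq> {0}"
  shows "norm a \<noteq> 1"
proof
  assume n1: "norm a = 1"
  have "\<exists>y. is_inverse y (1 - scaleC z a)" for z
  proof (cases "z = 0")
    case True
    then show ?thesis by (auto intro!: exI[of _ 1] simp: is_inverse_def)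
  next
    case False
    then have "1/z \<notin> spectrum a" using sp by auto
    then obtain y where y: "y * (a - scaleC (1/z) 1) = 1" "(a - scaleC (1/z) 1) * y = 1"
      by (auto simp: spectrum_def)
    have e: "1 - scaleC z a = scaleC (- z) (a - scaleC (1/z) 1)"
      using False by (simp add: scaleC_diff_right scaleC_scaleC scaleC_minus_left)
    have "is_inverse (scaleC (- 1/z) y) (1 - scaleC z a)"
      unfolding is_inverse_def e using False
      by (simp add: scaleC_mult_left scaleC_mult_right scaleC_scaleC y)
    then show ?thesis ..
  qed
  then obtain R where R: "\<And>z. is_inverse (R z) (1 - scaleC z a)" by metis
  have "uniformly_continuous_on (cball 0 2) R"
    using resolvent_continuous[OF R] by (intro compact_uniformly_continuous)
      (auto intro: continuous_on_subset)
  then obtain d where d: "d > 0"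
    "\<And>z w. z \<in> cball 0 2 \<Longrightarrow> w \<in> cball 0 2 \<Longrightarrow> dist w z < d \<Longrightarrow> dist (R w) (R z) < 1/8"
    unfolding uniformly_continuous_on_def by (metis zero_less_divide_1_iff zero_less_numeral)
  \<comment> \<open>the radii \<open>1 - e\<close> and \<open>1 + e\<close> are at most \<open>2\<close> and so close that \<open>R\<close> varies by at most \<open>1/8\<close> between
    corresponding points of the two circles\<close>
  define e where "e = min (d/4) (1/2)"
  have e: "e > 0" "e \<le> 1/2" "2 * e < d" using d(1) by (auto simp: e_def min_def)
  define s where "s = complex_of_real (1 - e)"
  define t where "t = complex_of_real (1 + e)"
  have avg: "\<exists>X Y. is_inverse X (1 - scaleC ((t * z) ^ (2^n)) (a ^ (2^n))) \<and>
      is_inverse Y (1 - scaleC ((s * z) ^ (2^n)) (a ^ (2^n))) \<and> norm (X - Y) \<le> 1/8"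
    if "cmod z = 1" for z n
    using that
  proof (induction n arbitrary: z)
    case 0
    have "dist (R (t * z)) (R (s * z)) < 1/8"
    proof (rule d(2))
      show "s * z \<in> cball 0 2" "t * z \<in> cball 0 2"
        using 0 e by (auto simp: s_def t_def norm_mult simp del: of_real_add of_real_diff)
      have "t * z - s * z = complex_of_real (2 * e) * z"
        by (simp add: t_def s_def algebra_simps)
      then show "dist (t * z) (s * z) < d"
        using 0 e by (simp add: dist_norm norm_mult)
    qed
    then show ?case using R[of "t * z"] R[of "s * z"]
      by (intro exI[of _ "R (t * z)"] exI[of _ "R (s * z)"]) (simp add: dist_norm)
  next
    case (Suc n)
    define \<zeta> where "\<zeta> = cis (pi / 2^n)"
    have \<zeta>: "\<zeta> ^ (2^n) = -1" "cmod \<zeta> = 1" by (simp_all add: \<zeta>_def Complex.DeMoivre)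
    let ?w = "\<lambda>r z. scaleC ((r * z) ^ (2^n)) (a ^ (2^n))"
    \<comment> \<open>rotating by \<open>\<zeta>\<close> changes the sign of the \<open>2 ^ n\<close>-th power\<close>
    have neg: "?w r (\<zeta> * z) = - ?w r z" for r
      by (simp add: power_mult_distrib \<zeta> scaleC_minus_left)
    have sq: "?w r z * ?w r z = scaleC ((r * z) ^ (2^Suc n)) (a ^ (2^Suc n))" for r
      by (simp add: scaleC_mult_left scaleC_mult_right scaleC_scaleC mult_2
          flip: power_add)
    obtain X Y where 1: "is_inverse X (1 - ?w t z)" "is_inverse Y (1 - ?w s z)"
      "norm (X - Y) \<le> 1/8"
      using Suc.IH[OF Suc.prems] by blast
    have "cmod (\<zeta> * z) = 1" using Suc.prems \<zeta> by (simp add: norm_mult)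
    from Suc.IH[OF this] obtain X' Y' where
      2: "is_inverse X' (1 + ?w t z)" "is_inverse Y' (1 + ?w s z)" "norm (X' - Y') \<le> 1/8"
      unfolding neg by auto
    have "scaleC (1/2) (X + X') - scaleC (1/2) (Y + Y') = scaleC (1/2) ((X - Y) + (X' - Y'))"
      by (simp add: algebra_simps flip: scaleC_diff_right)
    also have "norm \<dots> \<le> 1/2 * (1/8 + 1/8)"
      using norm_triangle_mono[OF 1(3) 2(3)] by (simp add: norm_scaleC)
    finally show ?case
      using is_inverse_square[OF 1(1) 2(1)] is_inverse_square[OF 1(2) 2(2)]
      unfolding sq by (intro exI conjI) auto
  qed
  have pow: "star (a ^ (2^n)) = a ^ (2^n) \<and> norm (a ^ (2^n)) = 1" for n
  proof (induction n)
    case 0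
    then show ?case by (simp add: sa n1)
  next
    case (Suc n)
    have "a ^ (2 ^ Suc n) = a ^ (2^n) * a ^ (2^n)" by (simp add: mult_2 power_add)
    then show ?case using Suc cstar_identity[of "a ^ (2^n)"] by (simp add: star_mult)
  qed
  have "(\<lambda>n. (1 - e) ^ n) \<longlonglongrightarrow> 0" using e by (intro LIMSEQ_realpow_zero) auto
  then have "\<forall>\<^sub>F n in sequentially. (1 - e) ^ n < 1/9"
    by (rule order_tendstoD) simp
  then obtain m where m: "(1 - e) ^ n < 1/9" if "n \<ge> m" for n
    unfolding eventually_sequentially by blast
  let ?N = "2 ^ m :: nat"
  have N: "(1 - e) ^ ?N < 1/9" by (rule m) (simp add: less_imp_le)
  obtain X Y where XY: "is_inverse X (1 - scaleC (t ^ ?N) (a ^ ?N))"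
    "is_inverse Y (1 - scaleC (s ^ ?N) (a ^ ?N))" "norm (X - Y) \<le> 1/8"
    using avg[of 1 m] by auto
  let ?p = "scaleC (s ^ ?N) (a ^ ?N)" and ?q = "scaleC (t ^ ?N) (a ^ ?N)"
  have np: "norm ?p < 1/9" using N e pow[of m]
    by (simp add: norm_scaleC norm_power s_def abs_of_nonneg del: of_real_diff)
  have nq: "norm ?q \<ge> 1" using e pow[of m]
    by (simp add: norm_scaleC norm_power t_def one_le_power del: of_real_add)
  \<comment> \<open>the element on the inner circle has inverse within \<open>1/8\<close> of \<open>1\<close>\<close>
  have "is_inverse 1 (1::'a)" by (simp add: is_inverse_def)
  from is_inverse_diff[OF XY(2) this] have Y1: "Y - 1 = Y * ?p" by simp
  then have Y2: "norm (Y - 1) \<le> norm Y * (1/9)"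
    using norm_mult_ineq[of Y ?p] np by (smt (verit) mult_left_mono norm_ge_zero)
  moreover have "norm Y \<le> 1 + norm (Y - 1)" using norm_triangle_sub[of Y 1] by simp
  ultimately have "norm (Y - 1) \<le> 1/8" by simp
  then have X1: "norm (1 - X) \<le> 1/4"
    using XY(3) norm_triangle_ineq[of "X - Y" "Y - 1"] by (simp add: norm_minus_commute)
  \<comment> \<open>hence the element on the outer circle is itself close to \<open>1\<close>\<close>
  have "- ?q = (1 - ?q) - X * (1 - ?q)" using XY(1) by (simp add: is_inverse_def)
  also have "\<dots> = (1 - X) * (1 - ?q)" by (simp add: algebra_simps)
  finally have "norm ?q = norm ((1 - X) * (1 - ?q))" by (metis norm_minus_cancel)
  then have "norm ?q \<le> 1/4 * norm (1 - ?q)"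
    using order_trans[OF norm_mult_ineq[of "1 - X" "1 - ?q"] mult_right_mono[OF X1 norm_ge_zero]]
    by simp
  moreover have "norm (1 - ?q) \<le> 1 + norm ?q" using norm_triangle_ineq4[of 1 ?q] by simp
  ultimately show False using nq by simp
qed

lemma self_adjoint_spectrum_0:
  fixes a :: "'a::unital_cstar_algebra"
  assumes sa: "star a = a" and sp: "spectrum a \<subseteq> {0}"
  shows "a = 0"
proof (rule ccontr)
  assume a0: "a \<noteq> 0"
  define r where "r = complex_of_real (1 / norm a)"
  have r0: "r \<noteq> 0" using a0 by (simp add: r_def)
  have "spectrum (scaleC r a) \<subseteq> {0}"
  proof
    fix c assume c: "c \<in> spectrum (scaleC r a)"
    have "c / r \<in> spectrum a"
    proof (rule ccontr)
      assume "c / r \<notin> spectrum a"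
      then obtain y where y: "y * (a - scaleC (c/r) 1) = 1" "(a - scaleC (c/r) 1) * y = 1"
        by (auto simp: spectrum_def)
      have "scaleC r a - scaleC c 1 = scaleC r (a - scaleC (c/r) 1)"
        using r0 by (simp add: scaleC_diff_right scaleC_scaleC)
      then have "scaleC (1/r) y * (scaleC r a - scaleC c 1) = 1"
        "(scaleC r a - scaleC c 1) * scaleC (1/r) y = 1"
        using r0 y by (simp_all add: scaleC_mult_left scaleC_mult_right scaleC_scaleC)
      then show False using c by (auto simp: spectrum_def)
    qed
    then show "c \<in> {0}" using sp r0 by auto
  qed
  moreover have "star (scaleC r a) = scaleC r a" using sa by (simp add: star_scaleC r_def)
  moreover have "norm (scaleC r a) = 1" using a0 by (simp add: norm_scaleC r_def norm_divide)
  ultimately show False using self_adjoint_spectrum_0_norm by blast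
qed

lemma spectrum_uminus: "c \<in> spectrum (a::'a::unital_cstar_algebra) \<Longrightarrow> - c \<in> spectrum (- a)"
proof -
  have e: "- a - scaleC (- c) 1 = - (a - scaleC c 1)" by (simp add: scaleC_minus_left)
  have "y * (- (a - scaleC c 1)) = (- y) * (a - scaleC c 1)"
    "(- (a - scaleC c 1)) * y = (a - scaleC c 1) * (- y)" for y by (simp_all only: mult_minus_left mult_minus_right)
  then show "c \<in> spectrum a \<Longrightarrow> - c \<in> spectrum (- a)"
    unfolding spectrum_def mem_Collect_eq e by metis
qed

lemma positive_element_antisym:
  fixes a :: "'a::unital_cstar_algebra"
  assumes "positive_element a" "positive_element (- a)"
  shows "a = 0"
proof (rule self_adjoint_spectrum_0)
  show "star a = a" using assms by (simp add: positive_element_def)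
  show "spectrum a \<subseteq> {0}"
  proof
    fix c assume c: "c \<in> spectrum a"
    obtain r where r: "r \<ge> 0" "c = complex_of_real r"
      using c assms(1) by (auto simp: positive_element_def)
    obtain q where q: "q \<ge> 0" "- c = complex_of_real q"
      using spectrum_uminus[OF c] assms(2) by (auto simp: positive_element_def)
    have "complex_of_real (r + q) = 0" by (simp flip: r(2) q(2))
    then have "r = 0" using r(1) q(1) by (simp only: of_real_eq_0_iff)
    then show "c \<in> {0}" using r(2) by simp
  qed
qed

section \<open>Crossed-product systems\<close>

text \<open>All but the faithfulness of \<open>E\<close> in the structure of a reduced twisted crossed product, as seen
  from inside the algebra: \<open>C\<close> is the coefficient algebra, \<open>v\<close> the implementing unitaries, and the
  cocycle is recovered as \<open>v g * v h * star (v (g \<otimes> h))\<close>. Both the given inclusion and an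
  arbitrary crossed product are of this form.\<close>

locale crossed_system = group G for G (structure) +
  fixes C :: "'d::unital_cstar_algebra set" and v :: "'g \<Rightarrow> 'd" and E :: "'d \<Rightarrow> 'd"
  assumes C: "unital_star_subalgebra C"
    and v_unitary: "g \<in> carrier G \<Longrightarrow> v g \<in> unitaries UNIV"
    and v_one: "v \<one> = 1"
    and cocycle_in: "g \<in> carrier G \<Longrightarrow> h \<in> carrier G \<Longrightarrow> v g * v h * star (v (g \<otimes> h)) \<in> C"
    and conj_in: "g \<in> carrier G \<Longrightarrow> c \<in> C \<Longrightarrow> v g * c * star (v g) \<in> C"
    and conj_star_in: "g \<in> carrier G \<Longrightarrow> c \<in> C \<Longrightarrow> star (v g) * c * v g \<in> C"
    and generated: "cstar_generated (C \<union> v ` carrier G) = UNIV"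
    and E: "conditional_expectation E C"
    and E_v: "g \<in> carrier G \<Longrightarrow> g \<noteq> \<one> \<Longrightarrow> E (v g) = 0"
begin

lemmas v_cancel = unitary_cancel[OF v_unitary]

lemma C_closed:
  "1 \<in> C" "x \<in> C \<Longrightarrow> y \<in> C \<Longrightarrow> x + y \<in> C" "x \<in> C \<Longrightarrow> y \<in> C \<Longrightarrow> x * y \<in> C"
  "x \<in> C \<Longrightarrow> scaleC a x \<in> C" "x \<in> C \<Longrightarrow> star x \<in> C" "0 \<in> C"
proof -
  show "0 \<in> C" using C scaleC_0 unfolding unital_star_subalgebra_def by metis
qed (use C in \<open>auto simp: unital_star_subalgebra_def\<close>)

lemma E_linear: "E (x + y) = E x + E y" "E (scaleC c x) = scaleC c (E x)"
  and E_in: "E x \<in> C"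
  and E_id: "b \<in> C \<Longrightarrow> E b = b"
  and E_bimodule: "b \<in> C \<Longrightarrow> d \<in> C \<Longrightarrow> E (b * x * d) = b * E x * d"
  and E_positive: "positive_element (E (star x * x))"
  and E_norm: "norm (E x) \<le> norm x"
  using E by (auto simp: conditional_expectation_def)

lemma E_left: "c \<in> C \<Longrightarrow> E (c * x) = c * E x"
  using E_bimodule[of c 1 x] C_closed by simp

lemma E_0: "E 0 = 0"
  using E_id C_closed by simp

lemma E_minus: "E (- x) = - E x"
  using E_linear(2)[of "-1" x] by (simp add: scaleC_minus1)

lemma E_diff: "E (x - y) = E x - E y"
  using E_linear(1)[of x "-y"] by (simp add: E_minus)

lemma E_sum: "E (\<Sum>i\<in>I. f i) = (\<Sum>i\<in>I. E (f i))"
  by (induction I rule: infinite_finite_induct) (simp_all add: E_linear E_0)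

lemma bounded_linear_E: "bounded_linear E"
  by (rule bounded_linear_intro[where K = 1]) (simp_all add: E_linear E_norm flip: scaleC_of_real)

lemma v_mult:
  assumes "g \<in> carrier G" "h \<in> carrier G"
  obtains s where "s \<in> C" "v g * v h = s * v (g \<otimes> h)"
  using that[OF cocycle_in[OF assms]] assms by (simp add: mult.assoc v_cancel)

lemma v_star:
  assumes g: "g \<in> carrier G"
  obtains s where "s \<in> C" "star (v g) = s * v (inv g)"
proof -
  let ?s = "v (inv g) * v g"
  have "?s \<in> C" using cocycle_in[of "inv g" g] g by (simp add: v_one)
  moreover have "star (v g) = star ?s * v (inv g)"
    using g by (simp add: star_mult mult.assoc v_cancel)
  ultimately show ?thesis using that[of "star ?s"] C_closed(5) by blast
qed

lemma v_shift: "g \<in> carrier G \<Longrightarrow> c \<in> C \<Longrightarrow> \<exists>d\<in>C. v g * c = d * v g"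
  by (rule bexI[of _ "v g * c * star (v g)"]) (simp_all add: mult.assoc v_cancel conj_in[unfolded mult.assoc])

lemma v_star_shift: "g \<in> carrier G \<Longrightarrow> c \<in> C \<Longrightarrow> \<exists>d\<in>C. star (v g) * c = d * star (v g)"
  by (rule bexI[of _ "star (v g) * c * v g"]) (simp_all add: mult.assoc v_cancel conj_star_in[unfolded mult.assoc])

text \<open>Up to coefficients in \<open>C\<close>, the element \<open>v g * star (v h)\<close> is \<open>v (g \<otimes> inv h)\<close>, and likewise on
  the other side.\<close>

lemma E_v_v_star:
  assumes g: "g \<in> carrier G" and h: "h \<in> carrier G" and "g \<noteq> h"
  shows "E (v g * star (v h)) = 0"
proof -
  let ?k = "g \<otimes> inv h"
  have k: "?k \<in> carrier G" "?k \<noteq> \<one>" "?k \<otimes> h = g"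
    using assms inv_equality[of g "inv h"] by (auto simp: m_assoc)
  have s: "v ?k * v h * star (v g) \<in> C" using cocycle_in[OF k(1) h] k(3) by simp
  have "v g * star (v h) = star (v ?k * v h * star (v g)) * v ?k"
    using g h k by (simp add: star_mult star_star mult.assoc v_cancel)
  then show ?thesis using E_left C_closed(5)[OF s] E_v[OF k(1,2)] by simp
qed

lemma E_star_v_v:
  assumes g: "g \<in> carrier G" and h: "h \<in> carrier G" and "g \<noteq> h"
  shows "E (star (v g) * v h) = 0"
proof -
  obtain s where s: "s \<in> C" "star (v g) = s * v (inv g)" using v_star[OF g] .
  obtain t where t: "t \<in> C" "v (inv g) * v h = t * v (inv g \<otimes> h)"
    using v_mult[OF inv_closed[OF g] h] .
  have "inv g \<otimes> h \<noteq> \<one>"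
  proof
    assume "inv g \<otimes> h = \<one>"
    then have "g \<otimes> (inv g \<otimes> h) = g" using g by simp
    then show False using assms by (simp flip: m_assoc)
  qed
  then have "E (v (inv g \<otimes> h)) = 0" using E_v g h by simp
  moreover have "star (v g) * v h = s * t * v (inv g \<otimes> h)" by (simp add: s(2) t(2) mult.assoc)
  ultimately show ?thesis using E_left[OF C_closed(3)[OF s(1) t(1)]] by simp
qed

subsection \<open>Density of the monomial span\<close>

inductive_set monomial_span where
  zero: "0 \<in> monomial_span"
| add: "c \<in> C \<Longrightarrow> g \<in> carrier G \<Longrightarrow> x \<in> monomial_span \<Longrightarrow> c * v g + x \<in> monomial_span"

lemma monomial_in_span: "c \<in> C \<Longrightarrow> g \<in> carrier G \<Longrightarrow> c * v g \<in> monomial_span"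
  using monomial_span.add[OF _ _ monomial_span.zero] by simp

lemma span_add: "x \<in> monomial_span \<Longrightarrow> y \<in> monomial_span \<Longrightarrow> x + y \<in> monomial_span"
  by (induction rule: monomial_span.induct) (auto simp: add.assoc intro: monomial_span.add)

lemma span_mult_left:
  assumes c: "c \<in> C" and g: "g \<in> carrier G" and x: "x \<in> monomial_span"
  shows "c * v g * x \<in> monomial_span"
  using x
proof induction
  case zero
  then show ?case by (simp add: monomial_span.zero)
next
  case (add d h x)
  obtain d' where d': "d' \<in> C" "v g * d = d' * v g" using v_shift[OF g add(1)] by blast
  obtain s where s: "s \<in> C" "v g * v h = s * v (g \<otimes> h)" using v_mult[OF g add(2)] .
  have "c * v g * (d * v h) = c * (v g * d) * v h" by (simp add: mult.assoc)
  also have "\<dots> = c * d' * s * v (g \<otimes> h)" by (simp add: d' s mult.assoc)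
  finally show ?case
    using add c g d' s by (simp add: distrib_left) (intro monomial_span.add, auto intro: C_closed)
qed

lemma span_mult: "x \<in> monomial_span \<Longrightarrow> y \<in> monomial_span \<Longrightarrow> x * y \<in> monomial_span"
  by (induction rule: monomial_span.induct) (auto simp: distrib_right intro: span_mult_left span_add monomial_span.zero)

lemma span_star: "x \<in> monomial_span \<Longrightarrow> star x \<in> monomial_span"
proof (induction rule: monomial_span.induct)
  case (add c g x)
  obtain s where s: "s \<in> C" "star (v g) = s * v (inv g)" using v_star[OF add(2)] .
  obtain d where d: "d \<in> C" "star (v g) * star c = d * star (v g)"
    using v_star_shift[OF add(2) C_closed(5)[OF add(1)]] by blast
  have "star (c * v g) = d * s * v (inv g)"
    by (simp add: star_mult d(2)) (simp add: s(2) mult.assoc)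
  then show ?case using add s d by (simp add: star_add monomial_span.add C_closed)
qed (simp add: monomial_span.zero)

lemma span_scaleC: "x \<in> monomial_span \<Longrightarrow> scaleC a x \<in> monomial_span"
proof (induction rule: monomial_span.induct)
  case (add c g x)
  then have "scaleC a c * v g + scaleC a x \<in> monomial_span" by (intro monomial_span.add C_closed) auto
  then show ?case by (simp add: scaleC_add_right scaleC_mult_left)
qed (simp add: monomial_span.zero)

lemma span_dense: "closure monomial_span = UNIV"
proof -
  have "1 \<in> monomial_span" using monomial_in_span[of 1 \<one>] C_closed v_one by simp
  then have "cstar_subalgebra (closure monomial_span)"
    by (intro cstar_subalgebra_closure)
      (simp add: unital_star_subalgebra_def span_add span_mult span_star span_scaleC)
  moreover have "C \<union> v ` carrier G \<subseteq> monomial_span"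
    using monomial_in_span[of _ \<one>] monomial_in_span[of 1] C_closed v_one by auto
  ultimately show ?thesis
    using cstar_generated_least[of "closure monomial_span"] closure_subset generated by blast
qed

subsection \<open>Finite index forces a finite group\<close>

lemma span_finite_support:
  assumes "x \<in> monomial_span"
  shows "finite {g \<in> carrier G. E (v g * x) \<noteq> 0}"
  using assms
proof induction
  case zero
  then show ?case by (simp add: E_0)
next
  case (add c h x)
  have "E (v g * (c * v h)) = 0" if g: "g \<in> carrier G" "g \<noteq> inv h" for g
  proof -
    obtain d where d: "d \<in> C" "v g * c = d * v g" using v_shift[OF g(1) add(1)] by blast
    obtain s where s: "s \<in> C" "v g * v h = s * v (g \<otimes> h)" using v_mult[OF g(1) add(2)] .
    have "g \<otimes> h \<noteq> \<one>" using g add(2) inv_equality by blast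
    then have "E (v (g \<otimes> h)) = 0" using E_v g add(2) by simp
    moreover have "v g * (c * v h) = d * s * v (g \<otimes> h)"
    proof -
      have "v g * (c * v h) = d * (v g * v h)" by (simp add: d(2) flip: mult.assoc)
      then show ?thesis by (simp add: s(2) mult.assoc)
    qed
    ultimately show ?thesis using E_left[OF C_closed(3)[OF d(1) s(1)]] by simp
  qed
  then have "{g \<in> carrier G. E (v g * (c * v h + x)) \<noteq> 0} \<subseteq>
      insert (inv h) {g \<in> carrier G. E (v g * x) \<noteq> 0}"
    by (auto simp: distrib_left E_linear)
  then show ?case using add(4) by (meson finite_insert finite_subset)
qed

text \<open>The quasi-basis elements are within \<open>\<epsilon>\<close> of the monomial span, so for all but finitely many
  \<open>g\<close> every coefficient \<open>E (v g * l)\<close> has norm at most \<open>\<epsilon>\<close>. For such \<open>g\<close> the quasi-basis formula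
  makes the unitary \<open>v g\<close> small, which is absurd.\<close>

lemma finite_index_imp_finite_group:
  assumes "finite_index E"
  shows "finite (carrier G)"
proof -
  obtain \<Lambda> where \<Lambda>: "finite \<Lambda>" "\<And>x. x = (\<Sum>l\<in>\<Lambda>. E (x * l) * star l)"
    using assms unfolding finite_index_def by blast
  define K where "K = (\<Sum>l\<in>\<Lambda>. norm l)"
  have K: "K \<ge> 0" by (simp add: K_def sum_nonneg)
  define e where "e = 1 / (K + 1)"
  have e: "e > 0" "e * K < 1" using K by (simp_all add: e_def)
  have "\<exists>p\<in>monomial_span. dist p l < e" for l
    using span_dense closure_approachable[of l monomial_span] e by auto
  then obtain p where p: "\<And>l. p l \<in> monomial_span" "\<And>l. dist (p l) l < e" by metis
  let ?S = "\<Union>l\<in>\<Lambda>. {g \<in> carrier G. E (v g * p l) \<noteq> 0}"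
  have "carrier G \<subseteq> ?S"
  proof (rule subsetI, rule ccontr)
    fix g assume g: "g \<in> carrier G" "g \<notin> ?S"
    have small: "norm (E (v g * l)) \<le> e" if "l \<in> \<Lambda>" for l
    proof -
      have "E (v g * l) = E (v g * (l - p l))"
        using g that by (simp add: right_diff_distrib E_diff)
      also have "norm \<dots> \<le> norm (v g) * norm (l - p l)"
        using E_norm norm_mult_ineq order_trans by blast
      also have "\<dots> \<le> e"
        using p(2)[of l] norm_unitary[OF v_unitary[OF g(1)]]
        by (simp add: dist_norm norm_minus_commute)
      finally show ?thesis .
    qed
    have "norm (v g) \<le> (\<Sum>l\<in>\<Lambda>. norm (E (v g * l) * star l))"
      by (subst \<Lambda>(2)[of "v g"]) (rule norm_sum)
    also have "\<dots> \<le> (\<Sum>l\<in>\<Lambda>. e * norm l)"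
    proof (rule sum_mono)
      fix l assume "l \<in> \<Lambda>"
      show "norm (E (v g * l) * star l) \<le> e * norm l"
        using norm_mult_ineq[of "E (v g * l)" "star l"] mult_right_mono[OF small[OF \<open>l \<in> \<Lambda>\<close>], of "norm l"]
        by (simp add: norm_star)
    qed
    also have "\<dots> = e * K" by (simp add: K_def sum_distrib_left)
    finally show False using e norm_unitary[OF v_unitary[OF g(1)]] by simp
  qed
  then show ?thesis using \<Lambda>(1) p(1) span_finite_support by (meson finite_UN finite_subset)
qed

subsection \<open>Fourier expansion over a finite group\<close>

definition coeff :: "'d \<Rightarrow> 'g \<Rightarrow> 'd" where
  "coeff x g = E (x * star (v g))"

lemma coeff_in: "coeff x g \<in> C"
  by (simp add: coeff_def E_in)

lemma coeff_add: "coeff (x + y) g = coeff x g + coeff y g"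
  by (simp add: coeff_def distrib_right E_linear)

lemma coeff_scaleC: "coeff (scaleC c x) g = scaleC c (coeff x g)"
  by (simp add: coeff_def scaleC_mult_left E_linear)

lemma coeff_monomial:
  assumes "c \<in> C" "g \<in> carrier G" "h \<in> carrier G"
  shows "coeff (c * v g) h = (if g = h then c else 0)"
  using assms E_v_v_star[of g h]
  by (simp add: coeff_def mult.assoc E_left v_cancel E_id C_closed)

text \<open>For finite \<open>G\<close> the elements that equal their Fourier expansion form a closed set, because the
  coefficients depend continuously on the element; this set contains the dense monomial span.\<close>

lemma fourier_expansion:
  assumes fin: "finite (carrier G)"
  shows "x = (\<Sum>g\<in>carrier G. coeff x g * v g)"
proof -
  let ?F = "\<lambda>x. \<Sum>g\<in>carrier G. coeff x g * v g"
  have "?F y = y" if "y \<in> monomial_span" for y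
    using that
  proof induction
    case zero
    then show ?case by (simp add: coeff_def E_0)
  next
    case (add c g x)
    have "?F (c * v g) = (\<Sum>h\<in>carrier G. if g = h then c * v h else 0)"
      using add by (intro sum.cong) (auto simp: coeff_monomial)
    also have "\<dots> = c * v g" using add fin by simp
    finally show ?case using add by (simp add: coeff_add distrib_right sum.distrib)
  qed
  then have "monomial_span \<subseteq> {y. ?F y = y}" by auto
  moreover have "closed {y. ?F y = y}"
    unfolding coeff_def
    by (intro closed_Collect_eq continuous_intros bounded_linear.continuous_on[OF bounded_linear_E])
  ultimately have "closure monomial_span \<subseteq> {y. ?F y = y}" by (rule closure_minimal)
  then have "?F x = x" using span_dense by auto
  then show ?thesis by (rule sym)
qed

lemma coeff_sum:
  assumes "finite (carrier G)" "\<And>g. g \<in> carrier G \<Longrightarrow> c g \<in> C" "h \<in> carrier G"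
  shows "coeff (\<Sum>g\<in>carrier G. c g * v g) h = c h"
proof -
  have "coeff (\<Sum>g\<in>carrier G. c g * v g) h = (\<Sum>g\<in>carrier G. coeff (c g * v g) h)"
    by (simp add: coeff_def sum_distrib_right E_sum)
  also have "\<dots> = (\<Sum>g\<in>carrier G. if g = h then c h else 0)"
    using assms by (intro sum.cong) (auto simp: coeff_monomial)
  finally show ?thesis using assms by simp
qed

text \<open>Let \<open>p\<close> be the \<open>h\<close>-th Fourier component of \<open>x\<close>. Distinct components are orthogonal for \<open>E\<close>,
  so \<open>E (star x * x)\<close> is the sum of \<open>E (star p * p) = star p * p\<close> and \<open>E (star y * y)\<close> with
  \<open>y = x - p\<close>. If the sum vanishes, \<open>star p * p\<close> and its negative are both positive. Splitting off
  one component at a time keeps both summands in the form \<open>E (star z * z)\<close>, which \<open>E\<close> makes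
  positive by definition.\<close>

lemma faithful_E:
  assumes fin: "finite (carrier G)"
  shows "faithful E"
  unfolding faithful_def
proof (intro allI impI)
  fix x assume x0: "E (star x * x) = 0"
  let ?p = "\<lambda>g. coeff x g * v g"
  have diag: "star (?p g) * ?p g \<in> C" if g: "g \<in> carrier G" for g
    using conj_star_in[OF g, of "star (coeff x g) * coeff x g"]
    by (simp add: star_mult mult.assoc coeff_in C_closed)
  have orth: "E (star (?p g) * ?p h) = 0" if gh: "g \<in> carrier G" "h \<in> carrier G" "g \<noteq> h" for g h
  proof -
    obtain d where d: "d \<in> C" "star (v g) * (star (coeff x g) * coeff x h) = d * star (v g)"
      using v_star_shift[OF gh(1), of "star (coeff x g) * coeff x h"]
      by (auto simp: coeff_in C_closed)
    have "star (?p g) * ?p h = (star (v g) * (star (coeff x g) * coeff x h)) * v h"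
      by (simp add: star_mult mult.assoc)
    also have "\<dots> = d * (star (v g) * v h)" by (simp add: d(2) mult.assoc)
    finally show ?thesis using E_star_v_v[OF gh] d(1) by (simp add: E_left)
  qed
  have "?p h = 0" if h: "h \<in> carrier G" for h
  proof -
    have x: "x = (\<Sum>g\<in>carrier G. ?p g)" by (rule fourier_expansion[OF fin])
    have left: "E (star x * ?p h) = star (?p h) * ?p h"
    proof -
      have "E (star x * ?p h) = (\<Sum>g\<in>carrier G. E (star (?p g) * ?p h))"
        by (subst x) (simp add: star_sum sum_distrib_right E_sum)
      also have "\<dots> = (\<Sum>g\<in>carrier G. if g = h then star (?p h) * ?p h else 0)"
        using h orth diag by (intro sum.cong) (auto simp: E_id)
      finally show ?thesis using fin h by simp
    qed
    have right: "E (star (?p h) * x) = star (?p h) * ?p h"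
    proof -
      have "E (star (?p h) * x) = (\<Sum>g\<in>carrier G. E (star (?p h) * ?p g))"
        by (subst x) (simp add: sum_distrib_left E_sum)
      also have "\<dots> = (\<Sum>g\<in>carrier G. if g = h then star (?p h) * ?p h else 0)"
        using h orth diag by (intro sum.cong) (auto simp: E_id)
      finally show ?thesis using fin h by simp
    qed
    have "E (star (x - ?p h) * (x - ?p h)) = - (star (?p h) * ?p h)"
      using x0 by (simp add: star_diff left_diff_distrib right_diff_distrib E_diff left right
          E_id[OF diag[OF h]])
    then have "positive_element (- (star (?p h) * ?p h))"
      using E_positive[of "x - ?p h"] by simp
    moreover have "positive_element (star (?p h) * ?p h)"
      using E_positive[of "?p h"] by (simp add: E_id[OF diag[OF h]])
    ultimately show ?thesis using positive_element_antisym star_mult_self_eq_0 by blast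
  qed
  then show "x = 0" using fourier_expansion[OF fin, of x] by simp
qed

end

section \<open>Uniqueness of the crossed product of a finite group\<close>

text \<open>The Fourier expansion shows that elements are determined by their coefficients and that all
  coefficient families occur, so the coefficient-wise map \<open>\<Phi>\<close> is a bijection; it is multiplicative
  because products of monomials are computed from the action and the cocycle alone.\<close>

lemma crossed_systems_isomorphic:
  fixes f :: "'a::unital_cstar_algebra \<Rightarrow> 'd::unital_cstar_algebra"
  assumes A: "crossed_system G B v E" and D: "crossed_system G D w E'"
    and fin: "finite (carrier G)" and f: "star_iso_on B D f" and f1: "f 1 = 1"
    and act: "\<And>g b. g \<in> carrier G \<Longrightarrow> b \<in> B \<Longrightarrow> w g * f b * star (w g) = f (v g * b * star (v g))"
    and coc: "\<And>g h. g \<in> carrier G \<Longrightarrow> h \<in> carrier G \<Longrightarrow>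
      w g * w h = f (v g * v h * star (v (g \<otimes>\<^bsub>G\<^esub> h))) * w (g \<otimes>\<^bsub>G\<^esub> h)"
  shows "inclusions_isomorphic B D"
proof -
  interpret A: crossed_system G B v E by (rule A)
  interpret D: crossed_system G D w E' by (rule D)
  have f_hom: "f (x + y) = f x + f y" "f (x * y) = f x * f y" "f (scaleC c x) = scaleC c (f x)"
    "f (star x) = star (f x)" if "x \<in> B" "y \<in> B" for x y c
    using f that by (auto simp: star_iso_on_def star_hom_on_def)
  have f_bij: "bij_betw f B D" using f by (simp add: star_iso_on_def)
  then have f_in: "f x \<in> D" if "x \<in> B" for x using that bij_betwE by blast
  have f0: "f 0 = 0" using f_hom(1)[of 0 0] A.C_closed by simp
  define \<Phi> where "\<Phi> x = (\<Sum>g\<in>carrier G. f (A.coeff x g) * w g)" for x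
  have \<Phi>_add: "\<Phi> (x + y) = \<Phi> x + \<Phi> y" for x y
    by (simp add: \<Phi>_def A.coeff_add f_hom A.coeff_in distrib_right sum.distrib)
  have \<Phi>_scaleC: "\<Phi> (scaleC c x) = scaleC c (\<Phi> x)" for c x
    by (simp add: \<Phi>_def A.coeff_scaleC f_hom(3)[OF A.coeff_in A.coeff_in] scaleC_mult_left scaleC_sum)
  have \<Phi>0: "\<Phi> 0 = 0" using \<Phi>_scaleC[of 0 0] by simp
  have \<Phi>_sum: "\<Phi> (\<Sum>i\<in>I. F i) = (\<Sum>i\<in>I. \<Phi> (F i))" for F and I :: "'b set"
    by (induction I rule: infinite_finite_induct) (simp_all add: \<Phi>_add \<Phi>0)
  have \<Phi>_mono: "\<Phi> (b * v g) = f b * w g" if "b \<in> B" "g \<in> carrier G" for b g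
  proof -
    have "\<Phi> (b * v g) = (\<Sum>h\<in>carrier G. if g = h then f b * w h else 0)"
      unfolding \<Phi>_def using that by (intro sum.cong) (auto simp: A.coeff_monomial f0)
    then show ?thesis using that fin by simp
  qed
  have \<Phi>_B: "\<Phi> b = f b" if "b \<in> B" for b
    using \<Phi>_mono[OF that A.one_closed] by (simp add: A.v_one D.v_one)
  have \<Phi>_v: "\<Phi> (v g) = w g" if "g \<in> carrier G" for g
    using \<Phi>_mono[of 1 g] that f1 A.C_closed by simp
  have expand: "x = (\<Sum>g\<in>carrier G. A.coeff x g * v g)" for x by (rule A.fourier_expansion[OF fin])
  have mono_mult: "\<Phi> ((b * v g) * (c * v h)) = \<Phi> (b * v g) * \<Phi> (c * v h)"
    if bc: "b \<in> B" "c \<in> B" and gh: "g \<in> carrier G" "h \<in> carrier G" for b c g h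
  proof -
    let ?c = "v g * c * star (v g)" and ?s = "v g * v h * star (v (g \<otimes>\<^bsub>G\<^esub> h))"
    have in_B: "?c \<in> B" "?s \<in> B" using bc gh A.conj_in A.cocycle_in by auto
    have "(b * v g) * (c * v h) = b * ?c * ?s * v (g \<otimes>\<^bsub>G\<^esub> h)"
      using gh by (simp add: mult.assoc A.v_cancel)
    then have "\<Phi> ((b * v g) * (c * v h)) = f (b * ?c * ?s) * w (g \<otimes>\<^bsub>G\<^esub> h)"
      using \<Phi>_mono[of "b * ?c * ?s" "g \<otimes>\<^bsub>G\<^esub> h"] bc gh in_B A.C_closed(3) by simp
    also have "f (b * ?c * ?s) = f b * f ?c * f ?s"
      using bc in_B by (simp only: f_hom(2) A.C_closed(3))
    also have "f b * f ?c * f ?s * w (g \<otimes>\<^bsub>G\<^esub> h) = f b * f ?c * (w g * w h)"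
      using coc[OF gh] by (simp only: mult.assoc)
    also have "\<dots> = f b * (w g * f c * star (w g)) * (w g * w h)"
      using act[OF gh(1) bc(2)] by simp
    also have "\<dots> = (f b * w g) * (f c * w h)" using gh by (simp add: mult.assoc D.v_cancel)
    finally show ?thesis using bc gh by (simp add: \<Phi>_mono)
  qed
  have \<Phi>_mult: "\<Phi> (x * y) = \<Phi> x * \<Phi> y" for x y
  proof -
    have "\<Phi> (x * y) = \<Phi> (\<Sum>g\<in>carrier G. \<Sum>h\<in>carrier G. (A.coeff x g * v g) * (A.coeff y h * v h))"
      by (subst expand[of x], subst expand[of y]) (simp only: sum_product)
    also have "\<dots> = (\<Sum>g\<in>carrier G. \<Sum>h\<in>carrier G. \<Phi> (A.coeff x g * v g) * \<Phi> (A.coeff y h * v h))"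
      unfolding \<Phi>_sum by (intro sum.cong refl mono_mult A.coeff_in)
    also have "\<dots> = \<Phi> (\<Sum>g\<in>carrier G. A.coeff x g * v g) * \<Phi> (\<Sum>h\<in>carrier G. A.coeff y h * v h)"
      by (simp only: \<Phi>_sum sum_product)
    finally show ?thesis by (simp only: expand[symmetric])
  qed
  \<comment> \<open>\<open>\<Phi> (star (v g))\<close> is inverse to \<open>\<Phi> (v g) = w g\<close>\<close>
  have \<Phi>_star_v: "\<Phi> (star (v g)) = star (w g)" if g: "g \<in> carrier G" for g
  proof -
    have "\<Phi> (star (v g)) * w g = 1"
      using \<Phi>_mult[of "star (v g)" "v g"] g \<Phi>_B[OF A.C_closed(1)] f1
      by (simp add: A.v_cancel \<Phi>_v)
    then have "\<Phi> (star (v g)) * w g * star (w g) = star (w g)" by simp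
    then show ?thesis using g by (simp add: mult.assoc D.v_cancel)
  qed
  have \<Phi>_star: "\<Phi> (star x) = star (\<Phi> x)" for x
  proof -
    have "\<Phi> (star x) = (\<Sum>g\<in>carrier G. \<Phi> (star (v g) * star (A.coeff x g)))"
      by (subst expand[of x]) (simp add: star_sum star_mult \<Phi>_sum)
    also have "\<dots> = (\<Sum>g\<in>carrier G. star (f (A.coeff x g) * w g))"
      by (intro sum.cong)
        (auto simp: \<Phi>_mult \<Phi>_star_v \<Phi>_B A.coeff_in A.C_closed f_hom(4)[OF A.coeff_in A.coeff_in] star_mult)
    finally show ?thesis by (simp add: \<Phi>_def star_sum)
  qed
  have coeff_\<Phi>: "D.coeff (\<Phi> x) g = f (A.coeff x g)" if "g \<in> carrier G" for x g
    unfolding \<Phi>_def using that by (intro D.coeff_sum[OF fin]) (auto simp: f_in A.coeff_in)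
  have "inj \<Phi>"
  proof (rule injI)
    fix x y assume "\<Phi> x = \<Phi> y"
    then have "f (A.coeff x g) = f (A.coeff y g)" if "g \<in> carrier G" for g
      using coeff_\<Phi>[OF that] by metis
    then have "A.coeff x g = A.coeff y g" if "g \<in> carrier G" for g
      using that f_bij A.coeff_in by (meson bij_betw_imp_inj_on inj_onD)
    then show "x = y" by (subst expand[of x], subst expand[of y]) simp
  qed
  moreover have "y \<in> range \<Phi>" for y
  proof -
    let ?b = "\<lambda>g. inv_into B f (D.coeff y g)"
    have b: "?b g \<in> B" "f (?b g) = D.coeff y g" for g
      using f_bij D.coeff_in by (auto simp: bij_betw_def inv_into_into f_inv_into_f)
    have "\<Phi> (\<Sum>g\<in>carrier G. ?b g * v g) = (\<Sum>g\<in>carrier G. D.coeff y g * w g)"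
      by (simp add: \<Phi>_sum \<Phi>_mono b)
    then show ?thesis using D.fourier_expansion[OF fin, of y] by (metis rangeI)
  qed
  ultimately have "star_iso_on UNIV UNIV \<Phi>"
    by (auto simp: star_iso_on_def star_hom_on_def bij_betw_def \<Phi>_add \<Phi>_mult \<Phi>_scaleC \<Phi>_star)
  moreover have "\<Phi> ` B = D" using \<Phi>_B f_bij by (simp add: bij_betw_def)
  ultimately show ?thesis unfolding inclusions_isomorphic_def by blast
qed

section \<open>Normalizers and the Weyl group\<close>

lemma normalizerD:
  assumes v: "v \<in> normalizer B"
  shows "v \<in> unitaries UNIV" "b \<in> B \<Longrightarrow> v * b * star v \<in> B" "b \<in> B \<Longrightarrow> star v * b * v \<in> B"
proof -
  show u: "v \<in> unitaries UNIV" using v by (simp add: normalizer_def)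
  have im: "(\<lambda>b. v * b * star v) ` B = B" using v by (simp add: normalizer_def)
  show "v * b * star v \<in> B" if "b \<in> B"
    by (rule subsetD[OF equalityD1[OF im] imageI[OF that]])
  show "star v * b * v \<in> B" if "b \<in> B"
  proof -
    have "b \<in> (\<lambda>b. v * b * star v) ` B" using that by (simp only: im)
    then obtain c where c: "c \<in> B" "b = v * c * star v" by (rule imageE)
    then show ?thesis by (simp add: mult.assoc unitary_cancel[OF u])
  qed
qed

lemma normalizerI:
  assumes u: "v \<in> unitaries UNIV"
    and 1: "\<And>b. b \<in> B \<Longrightarrow> v * b * star v \<in> B" and 2: "\<And>b. b \<in> B \<Longrightarrow> star v * b * v \<in> B"
  shows "v \<in> normalizer B"
proof -
  have "b \<in> (\<lambda>b. v * b * star v) ` B" if "b \<in> B" for b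
    using 2[OF that]
    by (intro image_eqI[of _ _ "star v * b * v"]) (simp_all add: mult.assoc unitary_cancel[OF u])
  then show ?thesis using u 1 by (auto simp: normalizer_def)
qed

lemma star_subalgebra_UNIV: "unital_star_subalgebra UNIV"
  by (simp add: unital_star_subalgebra_def)

lemma normalizer_mult:
  assumes "v \<in> normalizer B" "w \<in> normalizer B"
  shows "v * w \<in> normalizer B"
proof (rule normalizerI)
  show "v * w \<in> unitaries UNIV"
    using assms by (auto intro: unitaries_mult star_subalgebra_UNIV normalizerD)
  show "v * w * b * star (v * w) \<in> B" if "b \<in> B" for b
    using normalizerD(2)[OF assms(1) normalizerD(2)[OF assms(2) that]]
    by (simp add: star_mult mult.assoc)
  show "star (v * w) * b * (v * w) \<in> B" if "b \<in> B" for b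
    using normalizerD(3)[OF assms(2) normalizerD(3)[OF assms(1) that]]
    by (simp add: star_mult mult.assoc)
qed

lemma normalizer_star: "v \<in> normalizer B \<Longrightarrow> star v \<in> normalizer B"
  by (rule normalizerI)
    (auto simp: star_star intro: normalizerD unitaries_star star_subalgebra_UNIV)

lemma unitaries_in_normalizer:
  "unital_star_subalgebra B \<Longrightarrow> u \<in> unitaries B \<Longrightarrow> u \<in> normalizer B"
  by (rule normalizerI) (auto simp: unitaries_def unital_star_subalgebra_def)

lemma normalizer_in_B: "v \<in> normalizer B \<Longrightarrow> v \<in> B \<Longrightarrow> v \<in> unitaries B"
  using normalizerD(1) by (auto simp: unitaries_def)

text \<open>Since \<open>v * b = (v * b * star v) * v\<close>, the bimodule property shows that \<open>star v * E v\<close> commutes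
  with \<open>B\<close>; by irreducibility \<open>E v\<close> is a scalar multiple of \<open>v\<close>, and it lies in \<open>B\<close>.\<close>

lemma expectation_normalizer_eq_0:
  assumes B: "cstar_subalgebra B" and irr: "irreducible_inclusion B"
    and E: "conditional_expectation E B" and v: "v \<in> normalizer B" "v \<notin> unitaries B"
  shows "E v = 0"
proof -
  note vu = unitary_cancel[OF normalizerD(1)[OF v(1)]]
  have sB: "1 \<in> B" "\<And>c x. x \<in> B \<Longrightarrow> scaleC c x \<in> B" using B by (auto simp: cstar_subalgebra_def)
  have bim: "E (b * x * c) = b * E x * c" if "b \<in> B" "c \<in> B" for b c x
    using E that by (simp add: conditional_expectation_def)
  have "star v * E v * b = b * (star v * E v)" if b: "b \<in> B" for b
  proof -
    let ?b = "v * b * star v"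
    have "E v * b = E (v * b)" using bim[OF sB(1) b, of v] by simp
    also have "v * b = ?b * v" by (simp add: mult.assoc vu)
    also have "E (?b * v) = ?b * E v" using bim[OF normalizerD(2)[OF v(1) b] sB(1), of v] by simp
    finally have "star v * (E v * b) = star v * (?b * E v)" by simp
    then show ?thesis by (simp add: mult.assoc vu)
  qed
  then have "star v * E v \<in> range (\<lambda>c. scaleC c 1)"
    using irr unfolding irreducible_inclusion_def by blast
  then obtain c where "star v * E v = scaleC c 1" by auto
  then have "v * (star v * E v) = scaleC c v" by (simp add: scaleC_mult_right)
  then have Ev: "E v = scaleC c v" by (simp add: vu)
  have "c = 0"
  proof (rule ccontr)
    assume "c \<noteq> 0"
    then have "v = scaleC (1/c) (E v)" by (simp add: Ev scaleC_scaleC)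
    moreover have "E v \<in> B" using E by (simp add: conditional_expectation_def)
    ultimately have "v \<in> B" using sB(2) by metis
    then show False using v normalizer_in_B by blast
  qed
  then show ?thesis using Ev by simp
qed

lemma group_normalizer_group:
  assumes "unital_star_subalgebra B"
  shows "group (normalizer_group B)"
proof (rule groupI)
  fix x assume "x \<in> carrier (normalizer_group B)"
  then show "\<exists>y\<in>carrier (normalizer_group B). y \<otimes>\<^bsub>normalizer_group B\<^esub> x = \<one>\<^bsub>normalizer_group B\<^esub>"
    by (intro bexI[of _ "star x"])
      (auto simp: normalizer_group_def normalizer_star unitary_cancel dest: normalizerD(1))
next
  have "1 \<in> unitaries B" using assms by (simp add: unitaries_def unital_star_subalgebra_def)
  then show "\<one>\<^bsub>normalizer_group B\<^esub> \<in> carrier (normalizer_group B)"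
    using unitaries_in_normalizer[OF assms] by (simp add: normalizer_group_def)
qed (auto simp: normalizer_group_def normalizer_mult mult.assoc)

lemma normalizer_group_inv:
  assumes "unital_star_subalgebra B" "v \<in> normalizer B"
  shows "inv\<^bsub>normalizer_group B\<^esub> v = star v"
proof -
  interpret group "normalizer_group B" by (rule group_normalizer_group[OF assms(1)])
  show ?thesis
    using assms(2) unitary_cancel[OF normalizerD(1)[OF assms(2)]]
    by (intro inv_equality) (auto simp: normalizer_group_def normalizer_star)
qed

lemma unitaries_normal:
  assumes B: "unital_star_subalgebra B"
  shows "unitaries B \<lhd> normalizer_group B"
proof -
  interpret group "normalizer_group B" by (rule group_normalizer_group[OF B])
  have sub: "subgroup (unitaries B) (normalizer_group B)"
  proof (rule subgroupI)
    show "unitaries B \<subseteq> carrier (normalizer_group B)"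
      using unitaries_in_normalizer[OF B] by (auto simp: normalizer_group_def)
    have "1 \<in> unitaries B" using B by (simp add: unitaries_def unital_star_subalgebra_def)
    then show "unitaries B \<noteq> {}" by blast
  next
    fix a assume "a \<in> unitaries B"
    then show "inv\<^bsub>normalizer_group B\<^esub> a \<in> unitaries B"
      using normalizer_group_inv[OF B unitaries_in_normalizer[OF B]] unitaries_star[OF B] by simp
  qed (simp add: normalizer_group_def unitaries_mult[OF B])
  show ?thesis
    unfolding normal_inv_iff
  proof (intro conjI ballI sub)
    fix v u assume v: "v \<in> carrier (normalizer_group B)" and u: "u \<in> unitaries B"
    then have v': "v \<in> normalizer B" by (simp add: normalizer_group_def)
    have "v * u * star v \<in> normalizer B"
      by (rule normalizer_mult[OF normalizer_mult[OF v' unitaries_in_normalizer[OF B u]]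
            normalizer_star[OF v']])
    moreover have "v * u * star v \<in> B"
      using normalizerD(2)[OF v'] u by (simp add: unitaries_def)
    ultimately have "v * u * star v \<in> unitaries B" by (rule normalizer_in_B)
    then show "v \<otimes>\<^bsub>normalizer_group B\<^esub> u \<otimes>\<^bsub>normalizer_group B\<^esub> inv\<^bsub>normalizer_group B\<^esub> v \<in> unitaries B"
      by (simp add: normalizer_group_inv[OF B v']) (simp add: normalizer_group_def)
  qed
qed

lemma group_weyl_group: "unital_star_subalgebra B \<Longrightarrow> group (weyl_group B)"
  unfolding weyl_group_def by (intro normal.factorgroup_is_group unitaries_normal)

lemma weyl_group_one: "\<one>\<^bsub>weyl_group B\<^esub> = unitaries B"
  by (simp add: weyl_group_def FactGroup_def)

lemma carrier_weyl_group:
  "g \<in> carrier (weyl_group B) \<longleftrightarrow> (\<exists>v\<in>normalizer B. g = (\<lambda>u. u * v) ` unitaries B)"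
proof -
  have "unitaries B #>\<^bsub>normalizer_group B\<^esub> v = (\<lambda>u. u * v) ` unitaries B" for v
    by (auto simp: r_coset_def normalizer_group_def)
  then show ?thesis
    by (auto simp: weyl_group_def FactGroup_def RCOSETS_def) (auto simp: normalizer_group_def)
qed

lemma weyl_group_mult_mem:
  "v \<in> g \<Longrightarrow> w \<in> h \<Longrightarrow> v * w \<in> g \<otimes>\<^bsub>weyl_group B\<^esub> h"
  by (auto simp: weyl_group_def FactGroup_def set_mult_def normalizer_group_def)

text \<open>The neutral coset is represented by \<open>1\<close>, so that the resulting cocycle is normalized.\<close>

definition weyl_rep :: "'a::unital_cstar_algebra set \<Rightarrow> 'a set \<Rightarrow> 'a" where
  "weyl_rep B g = (if g = unitaries B then 1 else SOME v. v \<in> g)"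

context
  fixes B :: "'a::unital_cstar_algebra set"
  assumes B: "unital_star_subalgebra B"
begin

lemma one_in_unitaries: "1 \<in> unitaries B"
  using B by (simp add: unitaries_def unital_star_subalgebra_def)

lemma weyl_rep_in:
  assumes "g \<in> carrier (weyl_group B)"
  shows "weyl_rep B g \<in> g"
proof (cases "g = unitaries B")
  case True
  then show ?thesis using one_in_unitaries by (simp add: weyl_rep_def)
next
  case False
  have "\<exists>v. v \<in> g" using assms one_in_unitaries by (auto simp: carrier_weyl_group)
  then have "(SOME v. v \<in> g) \<in> g" by (rule someI_ex)
  then show ?thesis using False by (simp add: weyl_rep_def)
qed

lemma weyl_group_subset_normalizer:
  "g \<in> carrier (weyl_group B) \<Longrightarrow> v \<in> g \<Longrightarrow> v \<in> normalizer B"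
  by (auto simp: carrier_weyl_group intro: normalizer_mult unitaries_in_normalizer[OF B])

lemma weyl_group_same_coset:
  assumes "g \<in> carrier (weyl_group B)" "v \<in> g" "w \<in> g"
  shows "v * star w \<in> unitaries B"
proof -
  obtain x where x: "x \<in> normalizer B" "g = (\<lambda>u. u * x) ` unitaries B"
    using assms(1) by (auto simp: carrier_weyl_group)
  obtain a b where "a \<in> unitaries B" "b \<in> unitaries B" "v = a * x" "w = b * x"
    using assms(2,3) x(2) by blast
  then show ?thesis
    using unitaries_mult[OF B _ unitaries_star[OF B]]
    by (simp add: star_mult mult.assoc unitary_cancel[OF normalizerD(1)[OF x(1)]])
qed

lemma normalizer_in_weyl_coset:
  assumes v: "v \<in> normalizer B"
  shows "\<exists>g\<in>carrier (weyl_group B). v \<in> g"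
proof (rule bexI[of _ "(\<lambda>u. u * v) ` unitaries B"])
  show "v \<in> (\<lambda>u. u * v) ` unitaries B"
    using one_in_unitaries by (intro image_eqI[of _ _ 1]) auto
  show "(\<lambda>u. u * v) ` unitaries B \<in> carrier (weyl_group B)"
    using v by (auto simp: carrier_weyl_group)
qed

lemma weyl_rep_normalizer: "g \<in> carrier (weyl_group B) \<Longrightarrow> weyl_rep B g \<in> normalizer B"
  using weyl_group_subset_normalizer weyl_rep_in by blast

lemma weyl_rep_unitaries_iff:
  assumes g: "g \<in> carrier (weyl_group B)"
  shows "weyl_rep B g \<in> unitaries B \<longleftrightarrow> g = unitaries B"
proof
  assume u: "weyl_rep B g \<in> unitaries B"
  have U: "unitaries B \<in> carrier (weyl_group B)"
    using group.is_monoid[OF group_weyl_group[OF B], THEN monoid.one_closed]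
    by (simp add: weyl_group_one)
  obtain x where x: "x \<in> normalizer B" "g = (\<lambda>u. u * x) ` unitaries B"
    using g by (auto simp: carrier_weyl_group)
  obtain a where a: "a \<in> unitaries B" "weyl_rep B g = a * x" using weyl_rep_in[OF g] x(2) by blast
  have xU: "x \<in> unitaries B"
    using unitaries_mult[OF B unitaries_star[OF B a(1)] u] by (simp add: a(2) unitary_cancel[OF a(1)])
  have "y \<in> (\<lambda>u. u * x) ` unitaries B" if "y \<in> unitaries B" for y
    using unitaries_mult[OF B that unitaries_star[OF B xU]]
    by (intro image_eqI[of _ _ "y * star x"]) (simp_all add: mult.assoc unitary_cancel[OF xU])
  then show "g = unitaries B" using x(2) xU by (auto intro: unitaries_mult[OF B])
qed (use one_in_unitaries in \<open>simp add: weyl_rep_def\<close>)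

lemma weyl_cocycle_unitary:
  assumes gh: "g \<in> carrier (weyl_group B)" "h \<in> carrier (weyl_group B)"
  shows "weyl_rep B g * weyl_rep B h * star (weyl_rep B (g \<otimes>\<^bsub>weyl_group B\<^esub> h)) \<in> unitaries B"
proof -
  interpret group "weyl_group B" by (rule group_weyl_group[OF B])
  show ?thesis
    by (rule weyl_group_same_coset[OF m_closed[OF gh]
          weyl_group_mult_mem[OF weyl_rep_in[OF gh(1)] weyl_rep_in[OF gh(2)]]
          weyl_rep_in[OF m_closed[OF gh]]])
qed

end

text \<open>A normalizing unitary is a unitary of \<open>B\<close> times the representative of its coset, so \<open>B\<close> and
  the representatives generate whatever the normalizer generates.\<close>

lemma weyl_crossed_system:
  assumes cB: "cstar_subalgebra B" and reg: "regular_inclusion B" and irr: "irreducible_inclusion B"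
    and E: "conditional_expectation E B"
  shows "crossed_system (weyl_group B) B (weyl_rep B) E"
proof -
  note B = cstar_subalgebra_imp_star_subalgebra[OF cB]
  interpret group "weyl_group B" by (rule group_weyl_group[OF B])
  let ?v = "weyl_rep B"
  note norm = weyl_rep_normalizer[OF B]
  show ?thesis
  proof unfold_locales
    show "cstar_generated (B \<union> ?v ` carrier (weyl_group B)) = UNIV"
    proof -
      have "normalizer B \<subseteq> C" if C: "cstar_subalgebra C" "B \<union> ?v ` carrier (weyl_group B) \<subseteq> C" for C
      proof
        fix x assume x: "x \<in> normalizer B"
        obtain g where g: "g \<in> carrier (weyl_group B)" "x \<in> g"
          using normalizer_in_weyl_coset[OF B x] by blast
        have "x * star (?v g) \<in> B"
          using weyl_group_same_coset[OF B g weyl_rep_in[OF B g(1)]] by (simp add: unitaries_def)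
        then have "x * star (?v g) * ?v g \<in> C"
          using C g(1) unfolding cstar_subalgebra_def by blast
        then show "x \<in> C"
          by (simp add: mult.assoc unitary_cancel[OF normalizerD(1)[OF norm[OF g(1)]]])
      qed
      then have "cstar_generated (normalizer B) \<subseteq> cstar_generated (B \<union> ?v ` carrier (weyl_group B))"
        unfolding cstar_generated_def by blast
      then show ?thesis using reg by (auto simp: regular_inclusion_def)
    qed
    show "?v \<one>\<^bsub>weyl_group B\<^esub> = 1" by (simp add: weyl_group_one weyl_rep_def)
    fix g assume g: "g \<in> carrier (weyl_group B)"
    show "?v g \<in> unitaries UNIV" using norm[OF g] by (rule normalizerD(1))
    show "?v g * c * star (?v g) \<in> B" if "c \<in> B" for c using norm[OF g] that by (rule normalizerD(2))
    show "star (?v g) * c * ?v g \<in> B" if "c \<in> B" for c using norm[OF g] that by (rule normalizerD(3))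
    show "?v g * ?v h * star (?v (g \<otimes>\<^bsub>weyl_group B\<^esub> h)) \<in> B" if "h \<in> carrier (weyl_group B)" for h
      using weyl_cocycle_unitary[OF B g that] by (simp add: unitaries_def)
    assume "g \<noteq> \<one>\<^bsub>weyl_group B\<^esub>"
    then show "E (?v g) = 0"
      using weyl_rep_unitaries_iff[OF B g] expectation_normalizer_eq_0[OF cB irr E norm[OF g]]
      by (simp add: weyl_group_one)
  qed (use B E in auto)
qed

section \<open>The cocycle action of a crossed-product system\<close>

context crossed_system
begin

definition action :: "'g \<Rightarrow> 'd \<Rightarrow> 'd" where
  "action g x = v g * x * star (v g)"

definition cocycle :: "'g \<Rightarrow> 'g \<Rightarrow> 'd" where
  "cocycle g h = v g * v h * star (v (g \<otimes> h))"

lemma cocycle_unitary: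
  assumes "g \<in> carrier G" "h \<in> carrier G"
  shows "cocycle g h \<in> unitaries C"
  using assms cocycle_in[OF assms]
  by (simp add: cocycle_def unitaries_def star_mult star_star mult.assoc v_cancel)

lemma cocycle_action: "cocycle_action G C action cocycle"
  unfolding cocycle_action_def
proof (intro conjI ballI)
  show "group G" by (rule is_group)
  fix g assume g: "g \<in> carrier G"
  show "star_iso_on C C (action g)"
    unfolding star_iso_on_def star_hom_on_def
  proof (intro conjI ballI allI)
    show "bij_betw (action g) C C"
      using g conj_in conj_star_in
      by (intro bij_betwI[where g = "\<lambda>x. star (v g) * x * v g"])
        (auto simp: action_def mult.assoc v_cancel)
  qed (use g in \<open>simp_all add: action_def distrib_left distrib_right mult.assoc v_cancel star_mult
      star_star scaleC_mult_left scaleC_mult_right\<close>)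
  show "cocycle g \<one> = 1" "cocycle \<one> g = 1" using g by (simp_all add: cocycle_def v_one v_cancel)
  fix h assume h: "h \<in> carrier G"
  show "cocycle g h \<in> unitaries C" using g h by (rule cocycle_unitary)
  show "action g (action h b) = cocycle g h * action (g \<otimes> h) b * star (cocycle g h)" for b
    using g h by (simp add: action_def cocycle_def star_mult star_star mult.assoc v_cancel)
  fix k assume k: "k \<in> carrier G"
  show "cocycle g h * cocycle (g \<otimes> h) k = action g (cocycle h k) * cocycle g (h \<otimes> k)"
    using g h k by (simp add: action_def cocycle_def mult.assoc v_cancel m_assoc)
qed

lemma reduced_crossed_product_self:
  assumes "finite (carrier G)"
  shows "reduced_crossed_product G C action cocycle id v E"
  unfolding reduced_crossed_product_def
  using generated E E_v v_unitary faithful_E[OF assms]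
  by (auto simp: star_iso_on_def star_hom_on_def action_def cocycle_def mult.assoc v_cancel)

end

text \<open>This makes Fourier expansions available in an arbitrary crossed product. Normalization of the
  cocycle gives \<open>w \<one> * w \<one> = w \<one>\<close>, hence \<open>w \<one> = 1\<close>, and the surjectivity of \<open>\<alpha> g\<close> on \<open>B\<close> gives the
  invariance of \<open>\<iota> ` B\<close> under conjugation by \<open>star (w g)\<close>.\<close>

lemma reduced_crossed_product_system:
  assumes ca: "cocycle_action G B \<alpha> \<sigma>" and B: "unital_star_subalgebra B"
    and rcp: "reduced_crossed_product G B \<alpha> \<sigma> \<iota> w E"
  shows "crossed_system G (\<iota> ` B) w E"
proof -
  interpret group G using ca by (simp add: cocycle_action_def)
  have w: "w g \<in> unitaries UNIV" if "g \<in> carrier G" for g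
    using rcp that by (simp add: reduced_crossed_product_def)
  note wc = unitary_cancel[OF w]
  have mult: "w g * w h = \<iota> (\<sigma> g h) * w (g \<otimes>\<^bsub>G\<^esub> h)" if "g \<in> carrier G" "h \<in> carrier G" for g h
    using rcp that by (simp add: reduced_crossed_product_def)
  have act: "w g * \<iota> b * star (w g) = \<iota> (\<alpha> g b)" if "g \<in> carrier G" "b \<in> B" for g b
    using rcp that by (simp add: reduced_crossed_product_def)
  have hom: "star_hom_on B \<iota>" and \<iota>1: "\<iota> 1 = 1"
    using rcp by (simp_all add: reduced_crossed_product_def star_iso_on_def)
  have \<alpha>: "bij_betw (\<alpha> g) B B" if "g \<in> carrier G" for g
    using ca that by (simp add: cocycle_action_def star_iso_on_def)
  have \<sigma>: "\<sigma> g h \<in> B" if "g \<in> carrier G" "h \<in> carrier G" for g h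
    using ca that by (simp add: cocycle_action_def unitaries_def)
  show ?thesis
  proof unfold_locales
    have "1 \<in> \<iota> ` B" using \<iota>1 B by (metis image_eqI unital_star_subalgebra_def)
    moreover have "x + y \<in> \<iota> ` B" "x * y \<in> \<iota> ` B" "scaleC c x \<in> \<iota> ` B" "star x \<in> \<iota> ` B"
      if xy: "x \<in> \<iota> ` B" "y \<in> \<iota> ` B" for x y c
    proof -
      obtain a b where ab: "a \<in> B" "b \<in> B" "x = \<iota> a" "y = \<iota> b" using xy by blast
      have "x + y = \<iota> (a + b)" "x * y = \<iota> (a * b)" "scaleC c x = \<iota> (scaleC c a)" "star x = \<iota> (star a)"
        using hom ab by (simp_all add: star_hom_on_def)
      then show "x + y \<in> \<iota> ` B" "x * y \<in> \<iota> ` B" "scaleC c x \<in> \<iota> ` B" "star x \<in> \<iota> ` B"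
        using B ab by (auto simp: unital_star_subalgebra_def)
    qed
    ultimately show "unital_star_subalgebra (\<iota> ` B)" by (simp add: unital_star_subalgebra_def)
    have "\<sigma> \<one>\<^bsub>G\<^esub> \<one>\<^bsub>G\<^esub> = 1" using ca by (simp add: cocycle_action_def)
    then have "w \<one>\<^bsub>G\<^esub> * w \<one>\<^bsub>G\<^esub> = w \<one>\<^bsub>G\<^esub>" using mult[of "\<one>\<^bsub>G\<^esub>" "\<one>\<^bsub>G\<^esub>"] \<iota>1 by simp
    then have "star (w \<one>\<^bsub>G\<^esub>) * (w \<one>\<^bsub>G\<^esub> * w \<one>\<^bsub>G\<^esub>) = star (w \<one>\<^bsub>G\<^esub>) * w \<one>\<^bsub>G\<^esub>" by simp
    then show "w \<one>\<^bsub>G\<^esub> = 1" by (simp add: wc)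
    show "cstar_generated (\<iota> ` B \<union> w ` carrier G) = UNIV" "conditional_expectation E (\<iota> ` B)"
      using rcp by (simp_all add: reduced_crossed_product_def)
    fix g assume g: "g \<in> carrier G"
    show "w g \<in> unitaries UNIV" by (rule w[OF g])
    show "E (w g) = 0" if "g \<noteq> \<one>\<^bsub>G\<^esub>" using rcp g that by (simp add: reduced_crossed_product_def)
    show "w g * w h * star (w (g \<otimes>\<^bsub>G\<^esub> h)) \<in> \<iota> ` B" if h: "h \<in> carrier G" for h
      using g h \<sigma>[OF g h] by (simp add: mult mult.assoc wc)
    show "w g * c * star (w g) \<in> \<iota> ` B" if "c \<in> \<iota> ` B" for c
      using that act[OF g] bij_betwE[OF \<alpha>[OF g]] by auto
    show "star (w g) * c * w g \<in> \<iota> ` B" if "c \<in> \<iota> ` B" for c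
    proof -
      have "c \<in> \<iota> ` \<alpha> g ` B" using that \<alpha>[OF g] by (simp only: bij_betw_imp_surj_on)
      then obtain b where b: "b \<in> B" "c = \<iota> (\<alpha> g b)" by blast
      have "star (w g) * c * w g = \<iota> b"
        using g by (simp add: b(2) mult.assoc wc flip: act[OF g b(1)])
      then show ?thesis using b(1) by simp
    qed
  qed
qed

theorem corollary3p13:
  fixes B :: "'a::unital_cstar_algebra set"
  assumes "cstar_subalgebra B"
    and "simple_cstar (UNIV :: 'a set)"
    and "simple_cstar B"
    and "regular_inclusion B"
    and "irreducible_inclusion B"
    and "\<exists>E. conditional_expectation E B \<and> finite_index E"
  shows "\<exists>(\<alpha> :: 'a set \<Rightarrow> 'a \<Rightarrow> 'a) (\<sigma> :: 'a set \<Rightarrow> 'a set \<Rightarrow> 'a).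
    cocycle_action (weyl_group B) B \<alpha> \<sigma> \<and>
    outer_action (weyl_group B) B \<alpha> \<and>
    (\<exists>(\<iota> :: 'a \<Rightarrow> 'a) u E.
       reduced_crossed_product (weyl_group B) B \<alpha> \<sigma> \<iota> u E \<and> inclusions_isomorphic B (\<iota> ` B)) \<and>
    (\<forall>(\<iota> :: 'a \<Rightarrow> 'd::unital_cstar_algebra) u E.
       reduced_crossed_product (weyl_group B) B \<alpha> \<sigma> \<iota> u E \<longrightarrow> inclusions_isomorphic B (\<iota> ` B))"
proof -
  let ?G = "weyl_group B" and ?v = "weyl_rep B"
  obtain E where E: "conditional_expectation E B" "finite_index E" using assms(6) by blast
  note B = cstar_subalgebra_imp_star_subalgebra[OF assms(1)]
  have sys: "crossed_system ?G B ?v E" by (rule weyl_crossed_system[OF assms(1,4,5) E(1)])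
  interpret A: crossed_system ?G B ?v E by (rule sys)
  have fin: "finite (carrier ?G)" by (rule A.finite_index_imp_finite_group[OF E(2)])
  have "outer_action ?G B A.action"
    unfolding outer_action_def
  proof (intro ballI impI notI)
    fix g assume g: "g \<in> carrier ?G" "g \<noteq> \<one>\<^bsub>?G\<^esub>"
      and "\<exists>w\<in>unitaries B. \<forall>b\<in>B. A.action g b = w * b * star w"
    then obtain w where w: "w \<in> unitaries B" "\<And>b. b \<in> B \<Longrightarrow> ?v g * b * star (?v g) = w * b * star w"
      by (auto simp: A.action_def)
    \<comment> \<open>\<open>star w * ?v g\<close> commutes with \<open>B\<close>, hence is a scalar, and \<open>?v g\<close> lies in \<open>B\<close>\<close>
    have "star w * ?v g * b = b * (star w * ?v g)" if b: "b \<in> B" for b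
    proof -
      have "star w * (?v g * b * star (?v g)) * ?v g = star w * (w * b * star w) * ?v g"
        using w(2)[OF b] by simp
      then show ?thesis
        using g(1) by (simp add: mult.assoc A.v_cancel unitary_cancel[OF w(1)])
    qed
    then have "star w * ?v g \<in> range (\<lambda>c. scaleC c 1)"
      using assms(5) unfolding irreducible_inclusion_def by blast
    then obtain c where "star w * ?v g = scaleC c 1" by auto
    then have "w * (star w * ?v g) = scaleC c w" by (simp add: scaleC_mult_right)
    then have "?v g = scaleC c w" by (simp add: unitary_cancel[OF w(1)])
    then have "?v g \<in> B" using w(1) A.C_closed(4) by (simp add: unitaries_def)
    then have "?v g \<in> unitaries B" using weyl_rep_normalizer[OF B g(1)] by (intro normalizer_in_B)
    then show False using weyl_rep_unitaries_iff[OF B g(1)] g(2) by (simp add: weyl_group_one)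
  qed
  moreover have "inclusions_isomorphic B (id ` B)"
    unfolding inclusions_isomorphic_def
    by (rule exI[of _ id]) (simp add: star_iso_on_def star_hom_on_def)
  then have "\<exists>(\<iota> :: 'a \<Rightarrow> 'a) u E. reduced_crossed_product ?G B A.action A.cocycle \<iota> u E \<and>
      inclusions_isomorphic B (\<iota> ` B)"
    using A.reduced_crossed_product_self[OF fin] by blast
  moreover have "inclusions_isomorphic B (\<iota> ` B)"
    if rcp: "reduced_crossed_product ?G B A.action A.cocycle \<iota> w E'"
    for \<iota> :: "'a \<Rightarrow> 'd" and w E'
  proof (rule crossed_systems_isomorphic[OF sys _ fin])
    show "crossed_system ?G (\<iota> ` B) w E'"
      by (rule reduced_crossed_product_system[OF A.cocycle_action B rcp])
    show "star_iso_on B (\<iota> ` B) \<iota>" "\<iota> 1 = 1"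
      using rcp by (simp_all add: reduced_crossed_product_def)
    show "w g * \<iota> b * star (w g) = \<iota> (?v g * b * star (?v g))"
      if "g \<in> carrier ?G" "b \<in> B" for g b
      using rcp that by (simp add: reduced_crossed_product_def A.action_def)
    show "w g * w h = \<iota> (?v g * ?v h * star (?v (g \<otimes>\<^bsub>?G\<^esub> h))) * w (g \<otimes>\<^bsub>?G\<^esub> h)"
      if "g \<in> carrier ?G" "h \<in> carrier ?G" for g h
      using rcp that by (simp add: reduced_crossed_product_def A.cocycle_def)
  qed
  ultimately show ?thesis using A.cocycle_action by blast
qed

end
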